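(* Let $\underset{\sim}{\mathbf N}=(\{0,1\}^E;u_1,u_2,\preccurlyeq,\mathscr T)$ be as defined in the context. Then $\underset{\sim}{\mathbf N}\times\underset{\sim}{\mathbf N}$ (as an alter ego for $\mathbf M$, the generating algebra of $\mathscr{DB}_{-}$ described in the context) yields a strong duality on $\mathscr{DB}_{-}$. Moreover the dual category for this duality is $\mathscr Y:=\mathbb{IS}_{\mathrm c}\mathbb P^+(\underset{\sim}{\mathbf N})$, which may, in turn, be identified with the category $\mathscr P_{\mathscr{DO}}$ of double Ockham spaces.
   Context: **Bilattices with generalised conflation.** A bounded distributive bilattice is an algebra $(A;\lor_t,\land_t,\lor_k,\land_k,\neg,0,1)$ such that $\mathbf A_t=(A;\lor_t,\land_t)$ and $\mathbf A_k=(A;\lor_k,\land_k)$ are bounded lattices, each of the four lattice operations distributes over each of the other three, and $\neg$ is an involution which is an endomorphism of $\mathbf A_k$ and a dual endomorphism of $\mathbf A_t$; $0,1$ denote the bounds of $\mathbf A_t$ (the bounds of $\mathbf A_k$ are the terms $0\land_k1$, $0\lor_k1$). $\mathscr{DB}_{-}$ is the variety of algebras $(A;\lor_t,\land_t,\lor_k,\land_k,\neg,-,0,1)$ whose reduct without $-$ is a bounded distributive bilattice and in which $-$ is an endomorphism of the bounded lattice $\mathbf A_t$ and a dual endomorphism of the bounded lattice $\mathbf A_k$ (not assumed an involution, nor to commute with $\neg$). **The structures.** $E=\{e_1,e_2\}^*$ is the free monoid on $e_1,e_2$ (words under concatenation, identity the empty word), $|s|$ the length of $s$. $\mathbf N=(\{0,1\}^E;\lor,\land,f,g,0,1)$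 has pointwise lattice operations and constants and $f(a)(s)=1-a(s\cdot e_1)$, $g(a)(s)=1-a(s\cdot e_2)$. In $\underset{\sim}{\mathbf N}$: $\mathscr T$ is the product topology from the discrete topology on $\{0,1\}$; $u_i(a)=a\circ\gamma_i$ with $\gamma_i(s)=e_i\cdot s$ ($i=1,2$); $a\preccurlyeq b$ iff for all $s\in E$, $a(s)\le b(s)$ if $|s|$ is even and $a(s)\ge b(s)$ if $|s|$ is odd. The algebra $\mathbf M\in\mathscr{DB}_{-}$ has universe $N\times N$, where $N=\{0,1\}^E$, with $(a,b)\lor_t(c,d)=(a\lor c,b\land d)$, $(a,b)\land_t(c,d)=(a\land c,b\lor d)$, $(a,b)\lor_k(c,d)=(a\lor c,b\lor d)$, $(a,b)\land_k(c,d)=(a\land c,b\land d)$, $\neg(a,b)=(b,a)$, $-(a,b)=(f(b),g(a))$, and constants $(0,1)$ and $(1,0)$ interpreting $0$ and $1$. One has $\mathscr{DB}_{-}=\mathbb{ISP}(\mathbf M)$. The structure $\underset{\sim}{\mathbf N}\times\underset{\sim}{\mathbf N}$ is the square of $\underset{\sim}{\mathbf N}$ (universe $N\times N$, product topology, operations and order coordinatewise). **Natural dualities.** For a topological structure $\underset{\sim}{\mathbf S}$, $\mathbb{IS}_{\mathrm c}\mathbb P^+(\underset{\sim}{\mathbf S})$ is the class of isomorphic copies of closed substructures of non-empty powers of $\underset{\sim}{\mathbf S}$ (product topology, pointwise structure), including the empty structure; morphisms are the continuous structure-preserving maps. Let $\underset{\sim}{\mathbf M}=\underset{\sim}{\mathbf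 N}\times\underset{\sim}{\mathbf N}$ and $\mathscr X=\mathbb{IS}_{\mathrm c}\mathbb P^+(\underset{\sim}{\mathbf M})$. The contravariant hom-functors are $\mathsf D(\mathbf A)=\mathscr{DB}_{-}(\mathbf A,\mathbf M)$ (a closed substructure of $\underset{\sim}{\mathbf M}^A$) and $\mathsf E(\mathbf X)=\mathscr X(\mathbf X,\underset{\sim}{\mathbf M})$ (a subalgebra of $\mathbf M^X$), acting on morphisms by precomposition, with natural evaluation maps $e_{\mathbf A}\colon\mathbf A\to\mathsf E\mathsf D(\mathbf A)$ and $\varepsilon_{\mathbf X}\colon\mathbf X\to\mathsf D\mathsf E(\mathbf X)$. $\underset{\sim}{\mathbf M}$ yields a duality on $\mathscr{DB}_{-}$, with dual category $\mathscr X$, if every $e_{\mathbf A}$ is an isomorphism; the duality is full if in addition every $\varepsilon_{\mathbf X}$ is an isomorphism; it is strong if it is full and $\underset{\sim}{\mathbf M}$ is injective in $\mathscr X$ (with respect to embeddings). **Double Ockham spaces.** $\mathscr P_{\mathscr{DO}}$ is the category whose objects are Priestley spaces equipped with two continuous order-reversing self-maps $p,q$ and whose morphisms are the continuous order-preserving maps that preserve (commute with) $p$ and $q$. In the identification of $\mathscr Y$ with $\mathscr P_{\mathscr{DO}}$, the operations $u_1,u_2$ correspond to $p,q$. *)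

theory Defs
  imports "HOL-Analysis.Analysis"
begin

section \<open>Bounded distributive bilattices with generalised conflation\<close>

record 'a bilattice =
  carrier :: "'a set"
  join_t :: "'a \<Rightarrow> 'a \<Rightarrow> 'a"
  meet_t :: "'a \<Rightarrow> 'a \<Rightarrow> 'a"
  join_k :: "'a \<Rightarrow> 'a \<Rightarrow> 'a"
  meet_k :: "'a \<Rightarrow> 'a \<Rightarrow> 'a"
  neg :: "'a \<Rightarrow> 'a"
  conf :: "'a \<Rightarrow> 'a"
  zero :: 'a
  one :: 'a

definition bounded_lattice_on ::
    "'a set \<Rightarrow> ('a \<Rightarrow> 'a \<Rightarrow> 'a) \<Rightarrow> ('a \<Rightarrow> 'a \<Rightarrow> 'a) \<Rightarrow> 'a \<Rightarrow> 'a \<Rightarrow> bool" where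
  "bounded_lattice_on A j m z u \<longleftrightarrow>
     z \<in> A \<and> u \<in> A \<and>
     (\<forall>x\<in>A. \<forall>y\<in>A. j x y \<in> A \<and> m x y \<in> A \<and> j x y = j y x \<and> m x y = m y x \<and>
        j x (m x y) = x \<and> m x (j x y) = x) \<and>
     (\<forall>x\<in>A. \<forall>y\<in>A. \<forall>w\<in>A. j (j x y) w = j x (j y w) \<and> m (m x y) w = m x (m y w)) \<and>
     (\<forall>x\<in>A. j z x = x \<and> m u x = x)"

definition distributes_over_on ::
    "'a set \<Rightarrow> ('a \<Rightarrow> 'a \<Rightarrow> 'a) \<Rightarrow> ('a \<Rightarrow> 'a \<Rightarrow> 'a) \<Rightarrow> bool" where
  "distributes_over_on A f g \<longleftrightarrow> (\<forall>x\<in>A. \<forall>y\<in>A. \<forall>w\<in>A. f x (g y w) = g (f x y) (f x w))"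

text \<open>A self-map that is a lattice homomorphism from \<open>(A; j, m)\<close> to \<open>(A; j', m')\<close>. An
  endomorphism is the case \<open>j' = j\<close>, \<open>m' = m\<close>, a dual endomorphism the case \<open>j' = m\<close>, \<open>m' = j\<close>.\<close>

definition lattice_hom_on ::
    "'a set \<Rightarrow> ('a \<Rightarrow> 'a \<Rightarrow> 'a) \<Rightarrow> ('a \<Rightarrow> 'a \<Rightarrow> 'a) \<Rightarrow> ('a \<Rightarrow> 'a \<Rightarrow> 'a) \<Rightarrow> ('a \<Rightarrow> 'a \<Rightarrow> 'a) \<Rightarrow>
     ('a \<Rightarrow> 'a) \<Rightarrow> bool" where
  "lattice_hom_on A j m j' m' h \<longleftrightarrow>
     h \<in> A \<rightarrow> A \<and>
     (\<forall>x\<in>A. \<forall>y\<in>A. h (j x y) = j' (h x) (h y) \<and> h (m x y) = m' (h x) (h y))"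

abbreviation bot_k :: "'a bilattice \<Rightarrow> 'a" where
  "bot_k A \<equiv> meet_k A (zero A) (one A)"

abbreviation top_k :: "'a bilattice \<Rightarrow> 'a" where
  "top_k A \<equiv> join_k A (zero A) (one A)"

text \<open>Each lattice operation must distribute over the other three. The instances \<open>f = g\<close> below
  hold in every lattice, so they add nothing.\<close>

definition bounded_distributive_bilattice :: "'a bilattice \<Rightarrow> bool" where
  "bounded_distributive_bilattice A \<longleftrightarrow>
     bounded_lattice_on (carrier A) (join_t A) (meet_t A) (zero A) (one A) \<and>
     bounded_lattice_on (carrier A) (join_k A) (meet_k A) (bot_k A) (top_k A) \<and>
     (\<forall>f\<in>{join_t A, meet_t A, join_k A, meet_k A}. \<forall>g\<in>{join_t A, meet_t A, join_k A, meet_k A}.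
        distributes_over_on (carrier A) f g) \<and>
     (\<forall>x\<in>carrier A. neg A (neg A x) = x) \<and>
     lattice_hom_on (carrier A) (join_k A) (meet_k A) (join_k A) (meet_k A) (neg A) \<and>
     lattice_hom_on (carrier A) (join_t A) (meet_t A) (meet_t A) (join_t A) (neg A)"

definition DB_minus :: "'a bilattice \<Rightarrow> bool" where
  "DB_minus A \<longleftrightarrow>
     bounded_distributive_bilattice A \<and>
     lattice_hom_on (carrier A) (join_t A) (meet_t A) (join_t A) (meet_t A) (conf A) \<and>
     conf A (zero A) = zero A \<and> conf A (one A) = one A \<and>
     lattice_hom_on (carrier A) (join_k A) (meet_k A) (meet_k A) (join_k A) (conf A) \<and>
     conf A (bot_k A) = top_k A \<and> conf A (top_k A) = bot_k A"

text \<open>Homomorphisms are extensional functions on the carrier, so that they form a subset of a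
  power of the codomain.\<close>

definition alg_hom :: "'a bilattice \<Rightarrow> 'b bilattice \<Rightarrow> ('a \<Rightarrow> 'b) set" where
  "alg_hom A B = {h \<in> carrier A \<rightarrow>\<^sub>E carrier B.
     (\<forall>x\<in>carrier A. \<forall>y\<in>carrier A.
        h (join_t A x y) = join_t B (h x) (h y) \<and>
        h (meet_t A x y) = meet_t B (h x) (h y) \<and>
        h (join_k A x y) = join_k B (h x) (h y) \<and>
        h (meet_k A x y) = meet_k B (h x) (h y)) \<and>
     (\<forall>x\<in>carrier A. h (neg A x) = neg B (h x) \<and> h (conf A x) = conf B (h x)) \<and>
     h (zero A) = zero B \<and> h (one A) = one B}"

definition alg_iso :: "'a bilattice \<Rightarrow> 'b bilattice \<Rightarrow> ('a \<Rightarrow> 'b) set" where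
  "alg_iso A B = {h \<in> alg_hom A B. bij_betw h (carrier A) (carrier B)}"

definition alg_power :: "'m bilattice \<Rightarrow> 'i set \<Rightarrow> ('i \<Rightarrow> 'm) bilattice" where
  "alg_power M I =
     \<lparr>carrier = I \<rightarrow>\<^sub>E carrier M,
      join_t = (\<lambda>x y. \<lambda>i\<in>I. join_t M (x i) (y i)),
      meet_t = (\<lambda>x y. \<lambda>i\<in>I. meet_t M (x i) (y i)),
      join_k = (\<lambda>x y. \<lambda>i\<in>I. join_k M (x i) (y i)),
      meet_k = (\<lambda>x y. \<lambda>i\<in>I. meet_k M (x i) (y i)),
      neg = (\<lambda>x. \<lambda>i\<in>I. neg M (x i)),
      conf = (\<lambda>x. \<lambda>i\<in>I. conf M (x i)),
      zero = (\<lambda>i\<in>I. zero M),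
      one = (\<lambda>i\<in>I. one M)\<rparr>"


section \<open>Topological structures with two unary operations and a binary relation\<close>

text \<open>The universe of a structure is the \<open>topspace\<close> of its topology.\<close>

record 'x tstruct =
  tp :: "'x topology"
  rel :: "'x \<Rightarrow> 'x \<Rightarrow> bool"
  op1 :: "'x \<Rightarrow> 'x"
  op2 :: "'x \<Rightarrow> 'x"

abbreviation univ :: "'x tstruct \<Rightarrow> 'x set" where
  "univ X \<equiv> topspace (tp X)"

definition wf_struct :: "'x tstruct \<Rightarrow> bool" where
  "wf_struct X \<longleftrightarrow> op1 X \<in> univ X \<rightarrow> univ X \<and> op2 X \<in> univ X \<rightarrow> univ X"

definition mor :: "'x tstruct \<Rightarrow> 'y tstruct \<Rightarrow> ('x \<Rightarrow> 'y) set" where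
  "mor X Y = {f \<in> extensional (univ X).
     continuous_map (tp X) (tp Y) f \<and>
     (\<forall>x\<in>univ X. \<forall>y\<in>univ X. rel X x y \<longrightarrow> rel Y (f x) (f y)) \<and>
     (\<forall>x\<in>univ X. f (op1 X x) = op1 Y (f x) \<and> f (op2 X x) = op2 Y (f x))}"

definition struct_iso :: "'x tstruct \<Rightarrow> 'y tstruct \<Rightarrow> ('x \<Rightarrow> 'y) set" where
  "struct_iso X Y = {f \<in> mor X Y. wf_struct X \<and> wf_struct Y \<and>
     homeomorphic_map (tp X) (tp Y) f \<and>
     (\<forall>x\<in>univ X. \<forall>y\<in>univ X. rel Y (f x) (f y) \<longrightarrow> rel X x y)}"

definition restrict_struct :: "'x tstruct \<Rightarrow> 'x set \<Rightarrow> 'x tstruct" where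
  "restrict_struct X Y = X\<lparr>tp := subtopology (tp X) Y\<rparr>"

definition closed_subuniverse :: "'x tstruct \<Rightarrow> 'x set \<Rightarrow> bool" where
  "closed_subuniverse X Y \<longleftrightarrow> closedin (tp X) Y \<and> op1 X \<in> Y \<rightarrow> Y \<and> op2 X \<in> Y \<rightarrow> Y"

definition embedding :: "'x tstruct \<Rightarrow> 'y tstruct \<Rightarrow> ('x \<Rightarrow> 'y) set" where
  "embedding X Y = {f. closed_subuniverse Y (f ` univ X) \<and>
     f \<in> struct_iso X (restrict_struct Y (f ` univ X))}"

definition struct_power :: "'s tstruct \<Rightarrow> 'i set \<Rightarrow> ('i \<Rightarrow> 's) tstruct" where
  "struct_power S I =
     \<lparr>tp = product_topology (\<lambda>_. tp S) I,
      rel = (\<lambda>x y. \<forall>i\<in>I. rel S (x i) (y i)),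
      op1 = (\<lambda>x. \<lambda>i\<in>I. op1 S (x i)),
      op2 = (\<lambda>x. \<lambda>i\<in>I. op2 S (x i))\<rparr>"

definition struct_prod :: "'s tstruct \<Rightarrow> 't tstruct \<Rightarrow> ('s \<times> 't) tstruct" where
  "struct_prod S T =
     \<lparr>tp = prod_topology (tp S) (tp T),
      rel = (\<lambda>x y. rel S (fst x) (fst y) \<and> rel T (snd x) (snd y)),
      op1 = map_prod (op1 S) (op1 T),
      op2 = map_prod (op2 S) (op2 T)\<rparr>"

text \<open>Isomorphic copies of closed substructures of non-empty powers; the empty structure is
  included because a subuniverse may be empty. HOL cannot quantify over the type of the index
  set, so index sets are taken in the type of maps from the structure to \<open>S\<close>. The lemma
  \<open>in_IScP_plusI\<close> below shows that this loses no generality.\<close>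

definition in_IScP_plus :: "'s tstruct \<Rightarrow> 'x tstruct \<Rightarrow> bool" where
  "in_IScP_plus S X \<longleftrightarrow>
     (\<exists>(I :: ('x \<Rightarrow> 's) set) Y f. I \<noteq> {} \<and> closed_subuniverse (struct_power S I) Y \<and>
        f \<in> struct_iso X (restrict_struct (struct_power S I) Y))"

lemma in_IScP_plusI:
  fixes S :: "'s tstruct" and X :: "'x tstruct" and I :: "'i set"
  assumes "I \<noteq> {}" and Y: "closed_subuniverse (struct_power S I) Y"
    and f: "f \<in> struct_iso X (restrict_struct (struct_power S I) Y)"
  shows "in_IScP_plus S X"
proof -
  let ?P = "struct_power S I"
  define c where "c = (\<lambda>i x. f x i)"
  define J where "J = c ` I"
  define Q where "Q = struct_power S J"
  define r where "r = (\<lambda>z :: ('x \<Rightarrow> 's) \<Rightarrow> 's. \<lambda>i\<in>I. z (c i))"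
  define Y' where "Y' = {z \<in> univ Q. r z \<in> Y}"
  define g where "g = (\<lambda>x\<in>univ X. \<lambda>k\<in>J. k x)"
  have uP: "univ ?P = I \<rightarrow>\<^sub>E univ S" and uQ: "univ Q = J \<rightarrow>\<^sub>E univ S"
    by (simp_all add: struct_power_def Q_def)
  have YP: "Y \<subseteq> univ ?P"
    using Y closedin_subset unfolding closed_subuniverse_def by blast
  have Yop: "\<And>y. y \<in> Y \<Longrightarrow> op1 ?P y \<in> Y" "\<And>y. y \<in> Y \<Longrightarrow> op2 ?P y \<in> Y"
    using Y unfolding closed_subuniverse_def by auto
  have f': "f \<in> mor X (restrict_struct ?P Y)" "wf_struct X"
    and fh: "homeomorphic_map (tp X) (subtopology (tp ?P) Y) f"
    and frefl: "\<And>x y. x \<in> univ X \<Longrightarrow> y \<in> univ X \<Longrightarrow> rel ?P (f x) (f y) \<Longrightarrow> rel X x y"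
    using f by (auto simp: struct_iso_def restrict_struct_def)
  have frel: "\<And>x y. x \<in> univ X \<Longrightarrow> y \<in> univ X \<Longrightarrow> rel X x y \<Longrightarrow> rel ?P (f x) (f y)"
    and fop: "\<And>x. x \<in> univ X \<Longrightarrow> f (op1 X x) = op1 ?P (f x)"
             "\<And>x. x \<in> univ X \<Longrightarrow> f (op2 X x) = op2 ?P (f x)"
    using f'(1) by (auto simp: mor_def restrict_struct_def)
  have fim: "f ` univ X = Y"
    using homeomorphic_imp_surjective_map[OF fh] YP by (simp add: inf.absorb2)
  have wfX: "\<And>x. x \<in> univ X \<Longrightarrow> op1 X x \<in> univ X" "\<And>x. x \<in> univ X \<Longrightarrow> op2 X x \<in> univ X"
    using f'(2) by (auto simp: wf_struct_def)
  have fP: "f x \<in> I \<rightarrow>\<^sub>E univ S" if "x \<in> univ X" for x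
    using that fim YP uP by blast
  have fcont: "continuous_map (tp X) (tp S) (c i)" if "i \<in> I" for i
  proof -
    have "continuous_map (tp X) (tp ?P) f"
      using homeomorphic_imp_continuous_map[OF fh] by (rule continuous_map_into_fulltopology)
    then show ?thesis
      using that unfolding c_def struct_power_def
      by (auto simp: continuous_map_componentwise)
  qed
  have rcont: "continuous_map (tp Q) (tp ?P) r"
    unfolding Q_def struct_power_def r_def
    by (auto simp: continuous_map_componentwise J_def intro!: continuous_map_product_projection)
  have Y'Q: "Y' \<subseteq> univ Q"
    by (auto simp: Y'_def)
  have Y'closed: "closedin (tp Q) Y'"
    unfolding Y'_def
    using Y closedin_continuous_map_preimage[OF rcont] unfolding closed_subuniverse_def by blast
  have r_op: "r (op1 Q z) = op1 ?P (r z)" "r (op2 Q z) = op2 ?P (r z)" for z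
    by (auto simp: r_def Q_def struct_power_def J_def fun_eq_iff)
  have Qop: "op1 Q z \<in> Y'" "op2 Q z \<in> Y'" if z: "z \<in> Y'" for z
  proof -
    have rz: "r z \<in> Y" using z by (simp add: Y'_def)
    have "op1 ?P (r z) \<in> I \<rightarrow>\<^sub>E univ S" "op2 ?P (r z) \<in> I \<rightarrow>\<^sub>E univ S"
      using Yop[OF rz] YP uP by blast+
    then have "\<And>i. i \<in> I \<Longrightarrow> op1 S (z (c i)) \<in> univ S" "\<And>i. i \<in> I \<Longrightarrow> op2 S (z (c i)) \<in> univ S"
      by (auto simp: struct_power_def r_def PiE_def Pi_def)
    then have "op1 Q z \<in> univ Q" "op2 Q z \<in> univ Q"
      unfolding uQ by (auto simp: Q_def struct_power_def J_def)
    then show "op1 Q z \<in> Y'" "op2 Q z \<in> Y'"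
      using Yop[OF rz] by (auto simp: Y'_def r_op)
  qed
  have Y': "closed_subuniverse Q Y'"
    using Y'closed Qop by (auto simp: closed_subuniverse_def)
  have rg: "r (g x) = f x" if "x \<in> univ X" for x
    using fP[OF that] that by (auto simp: r_def g_def J_def c_def fun_eq_iff PiE_def extensional_def)
  have gY': "g x \<in> Y'" if "x \<in> univ X" for x
  proof -
    have "g x \<in> univ Q"
      using fP[OF that] that unfolding uQ by (auto simp: g_def J_def c_def)
    then show ?thesis
      using rg[OF that] fim that by (auto simp: Y'_def)
  qed
  have gr: "g x = z" if "x \<in> univ X" "z \<in> Y'" "f x = r z" for x z
  proof
    fix k
    have "z \<in> extensional J" using that(2) uQ by (auto simp: Y'_def PiE_def)
    moreover have "f x i = z (c i)" if "i \<in> I" for i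
      using \<open>f x = r z\<close> that by (simp add: r_def)
    ultimately show "g x k = z k"
      using that(1) by (auto simp: g_def J_def c_def extensional_def)
  qed
  obtain h where h: "homeomorphic_maps (tp X) (subtopology (tp ?P) Y) f h"
    using fh by (auto simp: homeomorphic_map_maps)
  have gcont: "continuous_map (tp X) (subtopology (tp Q) Y') g"
  proof -
    have "continuous_map (tp X) (tp Q) (\<lambda>x. \<lambda>k\<in>J. k x)"
      unfolding Q_def struct_power_def using fcont
      by (auto simp: continuous_map_componentwise J_def)
    then have "continuous_map (tp X) (tp Q) g"
      by (rule continuous_map_eq) (simp add: g_def)
    then show ?thesis
      using gY' by (auto simp: continuous_map_in_subtopology)
  qed
  have hrcont: "continuous_map (subtopology (tp Q) Y') (tp X) (h \<circ> r)"
  proof (rule continuous_map_compose)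
    show "continuous_map (subtopology (tp Q) Y') (subtopology (tp ?P) Y) r"
      using continuous_map_from_subtopology[OF rcont]
      by (auto simp: continuous_map_in_subtopology Y'_def)
    show "continuous_map (subtopology (tp ?P) Y) (tp X) h"
      using h by (simp add: homeomorphic_maps_def)
  qed
  have "homeomorphic_maps (tp X) (subtopology (tp Q) Y') g (h \<circ> r)"
    unfolding homeomorphic_maps_def
  proof (intro conjI gcont hrcont ballI)
    fix x assume "x \<in> univ X"
    then show "(h \<circ> r) (g x) = x"
      using h rg by (simp add: homeomorphic_maps_def)
  next
    fix z assume "z \<in> topspace (subtopology (tp Q) Y')"
    then have z: "z \<in> Y'" by simp
    then obtain x where "x \<in> univ X" "f x = r z"
      using fim by (auto simp: Y'_def image_iff)
    moreover from this have "h (r z) = x"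
      using h by (metis homeomorphic_maps_def)
    ultimately show "g ((h \<circ> r) z) = z"
      using gr z by simp
  qed
  then have ghom: "homeomorphic_map (tp X) (subtopology (tp Q) Y') g"
    by (auto simp: homeomorphic_map_maps)
  have grel: "rel Q (g x) (g y) \<longleftrightarrow> rel ?P (f x) (f y)" if "x \<in> univ X" "y \<in> univ X" for x y
    using that by (auto simp: Q_def struct_power_def g_def J_def c_def)
  have gop: "g (op1 X x) = op1 Q (g x)" "g (op2 X x) = op2 Q (g x)" if x: "x \<in> univ X" for x
    using gr[OF wfX(1)[OF x] Qop(1)[OF gY'[OF x]]] gr[OF wfX(2)[OF x] Qop(2)[OF gY'[OF x]]]
    by (simp_all add: r_op rg x fop)
  have "g \<in> struct_iso X (restrict_struct Q Y')"
    unfolding struct_iso_def mor_def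
    using gcont ghom grel gop frel frefl f'(2) Qop Y'Q
    by (auto simp: restrict_struct_def wf_struct_def g_def)
  moreover have "J \<noteq> {}"
    using assms(1) by (simp add: J_def)
  ultimately show ?thesis
    using Y' unfolding in_IScP_plus_def Q_def by blast
qed


section \<open>Natural dualities\<close>

definition dual_space :: "'m bilattice \<Rightarrow> 'm tstruct \<Rightarrow> 'a bilattice \<Rightarrow> ('a \<Rightarrow> 'm) tstruct" where
  "dual_space M S A = restrict_struct (struct_power S (carrier A)) (alg_hom A M)"

definition dual_algebra :: "'m bilattice \<Rightarrow> 'm tstruct \<Rightarrow> 'x tstruct \<Rightarrow> ('x \<Rightarrow> 'm) bilattice" where
  "dual_algebra M S X = (alg_power M (univ X))\<lparr>carrier := mor X S\<rparr>"

definition eval_alg :: "'m bilattice \<Rightarrow> 'a bilattice \<Rightarrow> 'a \<Rightarrow> ('a \<Rightarrow> 'm) \<Rightarrow> 'm" where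
  "eval_alg M A = (\<lambda>a\<in>carrier A. \<lambda>x\<in>alg_hom A M. x a)"

definition eval_struct :: "'m tstruct \<Rightarrow> 'x tstruct \<Rightarrow> 'x \<Rightarrow> ('x \<Rightarrow> 'm) \<Rightarrow> 'm" where
  "eval_struct S X = (\<lambda>x\<in>univ X. \<lambda>\<alpha>\<in>mor X S. \<alpha> x)"

text \<open>The \<open>itself\<close> arguments stand for the types over which algebras and structures range; a
  theorem that leaves them as type variables quantifies over all algebras and structures. The
  first two conjuncts say that the hom-functors are well defined on objects; the third one is the
  defining condition of a duality.\<close>

definition yields_duality ::
    "'a itself \<Rightarrow> 'x itself \<Rightarrow> 'm bilattice \<Rightarrow> 'm tstruct \<Rightarrow> bool" where
  "yields_duality _ _ M S \<longleftrightarrow>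
     (\<forall>A :: 'a bilattice. DB_minus A \<longrightarrow> in_IScP_plus S (dual_space M S A)) \<and>
     (\<forall>X :: 'x tstruct. in_IScP_plus S X \<longrightarrow> DB_minus (dual_algebra M S X)) \<and>
     (\<forall>A :: 'a bilattice. DB_minus A \<longrightarrow>
        eval_alg M A \<in> alg_iso A (dual_algebra M S (dual_space M S A)))"

definition yields_full_duality ::
    "'a itself \<Rightarrow> 'x itself \<Rightarrow> 'm bilattice \<Rightarrow> 'm tstruct \<Rightarrow> bool" where
  "yields_full_duality a x M S \<longleftrightarrow>
     yields_duality a x M S \<and>
     (\<forall>X :: 'x tstruct. in_IScP_plus S X \<longrightarrow>
        eval_struct S X \<in> struct_iso X (dual_space M S (dual_algebra M S X)))"

definition injective_in_IScP_plus :: "'x itself \<Rightarrow> 'y itself \<Rightarrow> 'm tstruct \<Rightarrow> bool" where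
  "injective_in_IScP_plus _ _ S \<longleftrightarrow>
     (\<forall>(X :: 'x tstruct) (Y :: 'y tstruct) \<phi> \<alpha>.
        in_IScP_plus S X \<and> in_IScP_plus S Y \<and> \<phi> \<in> embedding X Y \<and> \<alpha> \<in> mor X S \<longrightarrow>
        (\<exists>\<beta>\<in>mor Y S. \<forall>x\<in>univ X. \<beta> (\<phi> x) = \<alpha> x))"

definition yields_strong_duality ::
    "'a itself \<Rightarrow> 'x itself \<Rightarrow> 'y itself \<Rightarrow> 'm bilattice \<Rightarrow> 'm tstruct \<Rightarrow> bool" where
  "yields_strong_duality a x y M S \<longleftrightarrow>
     yields_full_duality a x M S \<and> injective_in_IScP_plus x y S"


section \<open>The structures \<open>N\<close> and \<open>M\<close>\<close>

datatype letter = e1 | e2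

text \<open>The free monoid on \<open>e1\<close>, \<open>e2\<close> is the type of lists with append, and the two-element set
  \<open>{0, 1}\<close> is \<open>bool\<close>, so the universe of \<open>N\<close> is a full function type. The pointwise lattice
  operations and constants are the library's \<open>\<squnion>\<close>, \<open>\<sqinter>\<close>, \<open>bot\<close>, \<open>top\<close> on functions into \<open>bool\<close>.\<close>

type_synonym N = "letter list \<Rightarrow> bool"

definition N_f :: "N \<Rightarrow> N" where
  "N_f a = (\<lambda>s. \<not> a (s @ [e1]))"

definition N_g :: "N \<Rightarrow> N" where
  "N_g a = (\<lambda>s. \<not> a (s @ [e2]))"

definition N_struct :: "N tstruct" where
  "N_struct =
     \<lparr>tp = product_topology (\<lambda>_. discrete_topology UNIV) UNIV,
      rel = (\<lambda>a b. \<forall>s. (even (length s) \<longrightarrow> a s \<le> b s) \<and> (odd (length s) \<longrightarrow> a s \<ge> b s)),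
      op1 = (\<lambda>a. a \<circ> (\<lambda>s. e1 # s)),
      op2 = (\<lambda>a. a \<circ> (\<lambda>s. e2 # s))\<rparr>"

definition M_alg :: "(N \<times> N) bilattice" where
  "M_alg =
     \<lparr>carrier = UNIV,
      join_t = (\<lambda>(a, b) (c, d). (sup a c, inf b d)),
      meet_t = (\<lambda>(a, b) (c, d). (inf a c, sup b d)),
      join_k = (\<lambda>(a, b) (c, d). (sup a c, sup b d)),
      meet_k = (\<lambda>(a, b) (c, d). (inf a c, inf b d)),
      neg = (\<lambda>(a, b). (b, a)),
      conf = (\<lambda>(a, b). (N_f b, N_g a)),
      zero = (bot, top),
      one = (top, bot)\<rparr>"


section \<open>Double Ockham spaces\<close>

definition priestley_space :: "'x topology \<Rightarrow> ('x \<Rightarrow> 'x \<Rightarrow> bool) \<Rightarrow> bool" where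
  "priestley_space T le \<longleftrightarrow>
     compact_space T \<and>
     (\<forall>x\<in>topspace T. le x x) \<and>
     (\<forall>x\<in>topspace T. \<forall>y\<in>topspace T. le x y \<and> le y x \<longrightarrow> x = y) \<and>
     (\<forall>x\<in>topspace T. \<forall>y\<in>topspace T. \<forall>z\<in>topspace T. le x y \<and> le y z \<longrightarrow> le x z) \<and>
     (\<forall>x\<in>topspace T. \<forall>y\<in>topspace T. \<not> le x y \<longrightarrow>
        (\<exists>U. openin T U \<and> closedin T U \<and>
           (\<forall>v\<in>U. \<forall>w\<in>topspace T. le v w \<longrightarrow> w \<in> U) \<and> x \<in> U \<and> y \<notin> U))"

definition double_ockham_space ::
    "'x topology \<Rightarrow> ('x \<Rightarrow> 'x \<Rightarrow> bool) \<Rightarrow> ('x \<Rightarrow> 'x) \<Rightarrow> ('x \<Rightarrow> 'x) \<Rightarrow> bool" where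
  "double_ockham_space T le p q \<longleftrightarrow>
     priestley_space T le \<and>
     continuous_map T T p \<and> continuous_map T T q \<and>
     (\<forall>x\<in>topspace T. \<forall>y\<in>topspace T. le x y \<longrightarrow> le (p y) (p x) \<and> le (q y) (q x))"

definition double_ockham_mor ::
    "'x topology \<Rightarrow> ('x \<Rightarrow> 'x \<Rightarrow> bool) \<Rightarrow> ('x \<Rightarrow> 'x) \<Rightarrow> ('x \<Rightarrow> 'x) \<Rightarrow>
     'y topology \<Rightarrow> ('y \<Rightarrow> 'y \<Rightarrow> bool) \<Rightarrow> ('y \<Rightarrow> 'y) \<Rightarrow> ('y \<Rightarrow> 'y) \<Rightarrow> ('x \<Rightarrow> 'y) set" where
  "double_ockham_mor T le p q T' le' p' q' = {f \<in> extensional (topspace T).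
     continuous_map T T' f \<and>
     (\<forall>x\<in>topspace T. \<forall>y\<in>topspace T. le x y \<longrightarrow> le' (f x) (f y)) \<and>
     (\<forall>x\<in>topspace T. f (p x) = p' (f x)) \<and> (\<forall>x\<in>topspace T. f (q x) = q' (f x))}"

end

theory Submission
  imports Defs
begin

text \<open>Both sides of the duality are governed by values at the empty word.

  On the topological side, evaluation at the empty word is a clopen up-set of \<open>N\<close>. The operations of
  \<open>N\<close> shift words, so a morphism \<open>\<alpha>\<close> from \<open>X\<close> to \<open>N\<close> is determined by the clopen up-set where
  \<open>\<alpha> x []\<close> holds: the value \<open>\<alpha> x s\<close> is its value at the point to which the word \<open>s\<close> moves \<open>x\<close>
  (\<open>mor_N_eq\<close>). Conversely every clopen up-set of a double Ockham space arises in this way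
  (\<open>orbit_map_mor\<close>); the order of \<open>N\<close> is reversed at words of odd length exactly because an odd
  number of order-reversing maps reverses the order. So \<open>N\<close> represents clopen up-sets, and
  \<open>N \<times> N\<close> represents pairs of them. In a Priestley space they separate points and order; together
  with compactness this embeds every double Ockham space in a power of \<open>N\<close>, or of \<open>N \<times> N\<close>, and the
  axioms of double Ockham spaces are inherited by closed substructures of powers. Hence both
  classes are the class of double Ockham spaces (\<open>IScP_plus_N_iff\<close>, \<open>IScP_plus_NN_iff\<close>).
  Injectivity of \<open>N \<times> N\<close> comes down to extending a clopen up-set from a closed subspace
  (\<open>clopen_upset_extension\<close>).

  On the algebraic side, call a predicate \<open>\<pi>\<close> on a bilattice bi-prime if it is a homomorphism onto the
  two-element lattice for the truth operations and for the knowledge operations, with \<open>0\<close> and \<open>1\<close>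
  going to the bounds. If \<open>h\<close> is a homomorphism into \<open>M\<close>, then the predicate \<open>fst (h a) []\<close> of \<open>a\<close> is
  bi-prime and determines \<open>h\<close>: negation gives the second coordinate, and the composites of negation
  and conflation, which are dual endomorphisms of both lattices, give the values at longer words
  (\<open>hom_fst_spread\<close>). Every bi-prime predicate comes from a homomorphism (\<open>hom_of_in_alg_hom\<close>).
  There are enough of them: below \<open>1\<close> in the knowledge order the truth operations coincide with the
  knowledge operations (\<open>meet_one_t_eq_k\<close>), so a prime filter of the knowledge lattice that contains
  \<open>1\<close> is bi-prime, and an element \<open>a\<close> is recovered from the parts of \<open>a\<close> and of its negation below
  \<open>1\<close> (\<open>bi_prime_separates\<close>). This makes the evaluation maps of algebras injective.

  Surjectivity of the evaluation maps is compactness, used twice. A morphism from the dual space of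
  \<open>A\<close> to \<open>N \<times> N\<close> is a pair of clopen up-sets, each of the form \<open>fst (h b) []\<close> for some \<open>b\<close> in \<open>A\<close>
  (\<open>D_upset_represented\<close>), and two such elements are glued into one by means of the bounds. For a
  space \<open>X\<close>, a bi-prime predicate on the dual algebra is evaluation at a point, since otherwise
  finitely many witnesses would violate its monotonicity (\<open>bi_prime_dual_algebra_is_point\<close>).\<close>

section \<open>Clopen predicates and compactness\<close>

text \<open>Continuity into \<open>N\<close> is continuity of all coordinates, and a map into the discrete two-point space
  is continuous iff it is a clopen predicate. Phrased with predicates rather than sets, the closure
  properties below match the Boolean operations that define \<open>M\<close>.\<close>

definition clopenp :: "'x topology \<Rightarrow> ('x \<Rightarrow> bool) \<Rightarrow> bool" where
  "clopenp T P \<longleftrightarrow> openin T {x \<in> topspace T. P x} \<and> closedin T {x \<in> topspace T. P x}"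

lemma clopenp_cong:
  "(\<And>x. x \<in> topspace T \<Longrightarrow> P x \<longleftrightarrow> Q x) \<Longrightarrow> clopenp T P \<longleftrightarrow> clopenp T Q"
  unfolding clopenp_def by (metis (mono_tags, lifting) Collect_cong)

lemma clopenp_const: "clopenp T (\<lambda>x. c)"
  by (cases c) (simp_all add: clopenp_def)

lemma clopenp_not: "clopenp T P \<Longrightarrow> clopenp T (\<lambda>x. \<not> P x)"
proof -
  have "{x \<in> topspace T. \<not> P x} = topspace T - {x \<in> topspace T. P x}" by auto
  then show "clopenp T P \<Longrightarrow> clopenp T (\<lambda>x. \<not> P x)"
    by (simp add: clopenp_def closedin_diff openin_diff)
qed

lemma clopenp_conj: "clopenp T P \<Longrightarrow> clopenp T Q \<Longrightarrow> clopenp T (\<lambda>x. P x \<and> Q x)"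
proof -
  have "{x \<in> topspace T. P x \<and> Q x} = {x \<in> topspace T. P x} \<inter> {x \<in> topspace T. Q x}" by auto
  then show "clopenp T P \<Longrightarrow> clopenp T Q \<Longrightarrow> ?thesis"
    by (simp add: clopenp_def openin_Int closedin_Int)
qed

lemma clopenp_disj: "clopenp T P \<Longrightarrow> clopenp T Q \<Longrightarrow> clopenp T (\<lambda>x. P x \<or> Q x)"
  using clopenp_not[OF clopenp_conj[OF clopenp_not[of T P] clopenp_not[of T Q]]] by simp

lemma clopenp_iff:
  assumes "clopenp T P" "clopenp T Q"
  shows "clopenp T (\<lambda>x. P x \<longleftrightarrow> Q x)"
proof -
  have "(P x \<longleftrightarrow> Q x) = (P x \<and> Q x \<or> \<not> P x \<and> \<not> Q x)" for x by blast
  then show ?thesis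
    using assms by (simp add: clopenp_disj clopenp_conj clopenp_not)
qed

lemma clopenp_compose:
  assumes "continuous_map T T' f" "clopenp T' P"
  shows "clopenp T (\<lambda>x. P (f x))"
proof -
  have "{x \<in> topspace T. P (f x)} = {x \<in> topspace T. f x \<in> {y \<in> topspace T'. P y}}"
    using continuous_map_image_subset_topspace[OF assms(1)] by auto
  then show ?thesis
    using openin_continuous_map_preimage[OF assms(1), of "{y \<in> topspace T'. P y}"]
      closedin_continuous_map_preimage[OF assms(1), of "{y \<in> topspace T'. P y}"] assms(2)
    by (simp add: clopenp_def)
qed

lemma continuous_map_into_discrete_bool:
  "continuous_map T (discrete_topology UNIV) P \<longleftrightarrow> clopenp T P"
proof
  have "clopenp (discrete_topology UNIV) (\<lambda>b. b)" by (simp add: clopenp_def)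
  then show "continuous_map T (discrete_topology UNIV) P \<Longrightarrow> clopenp T P"
    by (rule clopenp_compose[of _ _ P, rotated])
next
  assume P: "clopenp T P"
  have "openin T {x \<in> topspace T. P x \<in> B}" for B
  proof -
    have "clopenp T (\<lambda>x. P x \<in> B)"
      using clopenp_disj[OF clopenp_conj[OF P clopenp_const[of T "True \<in> B"]]
          clopenp_conj[OF clopenp_not[OF P] clopenp_const[of T "False \<in> B"]]]
      by (rule iffD1[OF clopenp_cong, rotated]) (metis (full_types))
    then show ?thesis by (simp add: clopenp_def)
  qed
  then show "continuous_map T (discrete_topology UNIV) P"
    by (simp add: continuous_map_def)
qed

text \<open>A finite subcover, packaged as an induction principle: a property of sets that is inherited by
  subsets and finite unions and holds locally holds on compact sets.\<close>

lemma compactin_local_to_global: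
  assumes "compactin T K" and "\<Phi> {}" and "\<And>A B. \<Phi> A \<Longrightarrow> \<Phi> B \<Longrightarrow> \<Phi> (A \<union> B)"
    and mono: "\<And>A B. A \<subseteq> B \<Longrightarrow> \<Phi> B \<Longrightarrow> \<Phi> A"
    and local: "\<And>x. x \<in> K \<Longrightarrow> \<exists>W. openin T W \<and> x \<in> W \<and> \<Phi> W"
  shows "\<Phi> K"
proof -
  have "K \<subseteq> \<Union>{W. openin T W \<and> \<Phi> W}"
    using local by blast
  then obtain \<F> where F: "finite \<F>" "\<F> \<subseteq> {W. openin T W \<and> \<Phi> W}" "K \<subseteq> \<Union>\<F>"
    using assms(1) unfolding compactin_def by (metis (no_types, lifting) mem_Collect_eq)
  from F(1,2) have "\<Phi> (\<Union>\<F>)"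
    by (induction \<F>) (use assms(2,3) in auto)
  with F(3) show ?thesis
    using mono by blast
qed

text \<open>The standard two-step compactness argument behind Priestley duality. For fixed \<open>x\<close>, covering \<open>V\<close>
  gives a meet of predicates that contains \<open>x\<close> and avoids \<open>V\<close>; covering \<open>U\<close> by these gives a join.
  The predicates are indexed by \<open>J\<close> and closed under meets and joins only up to equality on the
  space, so that \<open>J\<close> may be the carrier of an algebra.\<close>

lemma compact_separation:
  fixes p :: "'i \<Rightarrow> 'x \<Rightarrow> bool"
  assumes T: "compact_space T" and U: "closedin T U" and V: "closedin T V"
    and clop: "\<And>i. i \<in> J \<Longrightarrow> clopenp T (p i)"
    and top: "\<exists>i\<in>J. \<forall>x\<in>topspace T. p i x" and bot: "\<exists>i\<in>J. \<forall>x\<in>topspace T. \<not> p i x"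
    and meet: "\<And>i j. i \<in> J \<Longrightarrow> j \<in> J \<Longrightarrow> \<exists>k\<in>J. \<forall>x\<in>topspace T. p k x \<longleftrightarrow> p i x \<and> p j x"
    and join: "\<And>i j. i \<in> J \<Longrightarrow> j \<in> J \<Longrightarrow> \<exists>k\<in>J. \<forall>x\<in>topspace T. p k x \<longleftrightarrow> p i x \<or> p j x"
    and sep: "\<And>x y. x \<in> U \<Longrightarrow> y \<in> V \<Longrightarrow> \<exists>i\<in>J. p i x \<and> \<not> p i y"
  shows "\<exists>i\<in>J. (\<forall>x\<in>U. p i x) \<and> (\<forall>y\<in>V. \<not> p i y)"
proof -
  have Us: "U \<subseteq> topspace T" and Vs: "V \<subseteq> topspace T"
    using U V by (simp_all add: closedin_subset)
  have op: "openin T {x \<in> topspace T. p i x}" "openin T {x \<in> topspace T. \<not> p i x}" if "i \<in> J" for i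
    using clop[OF that] clopenp_not[OF clop[OF that]] by (auto simp: clopenp_def)
  have point: "\<exists>i\<in>J. p i x \<and> (\<forall>y\<in>V. \<not> p i y)" if x: "x \<in> U" for x
  proof -
    have "\<exists>i\<in>J. p i x \<and> (\<forall>y\<in>V \<inter> topspace T. \<not> p i y)"
    proof (rule compactin_local_to_global[OF closedin_compact_space[OF T V],
          where \<Phi> = "\<lambda>W. \<exists>i\<in>J. p i x \<and> (\<forall>y\<in>W \<inter> topspace T. \<not> p i y)"])
      show "\<exists>i\<in>J. p i x \<and> (\<forall>y\<in>{} \<inter> topspace T. \<not> p i y)"
        using top x Us by blast
    next
      fix A B
      assume "\<exists>i\<in>J. p i x \<and> (\<forall>y\<in>A \<inter> topspace T. \<not> p i y)"
        "\<exists>i\<in>J. p i x \<and> (\<forall>y\<in>B \<inter> topspace T. \<not> p i y)"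
      then obtain i j where ij: "i \<in> J" "p i x" "\<forall>y\<in>A \<inter> topspace T. \<not> p i y"
        "j \<in> J" "p j x" "\<forall>y\<in>B \<inter> topspace T. \<not> p j y" by blast
      obtain k where "k \<in> J" "\<forall>x\<in>topspace T. p k x \<longleftrightarrow> p i x \<and> p j x"
        using meet[of i j] ij by blast
      with ij x Us show "\<exists>i\<in>J. p i x \<and> (\<forall>y\<in>(A \<union> B) \<inter> topspace T. \<not> p i y)"
        by (intro bexI[of _ k]) auto
    next
      fix y assume y: "y \<in> V"
      then obtain i where "i \<in> J" "p i x" "\<not> p i y" using sep x by blast
      with op(2)[of i] y Vs
      show "\<exists>W. openin T W \<and> y \<in> W \<and> (\<exists>i\<in>J. p i x \<and> (\<forall>y\<in>W \<inter> topspace T. \<not> p i y))"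
        by (intro exI[of _ "{y \<in> topspace T. \<not> p i y}"]) auto
    qed blast
    then show ?thesis using Vs by blast
  qed
  have "\<exists>i\<in>J. (\<forall>x\<in>U \<inter> topspace T. p i x) \<and> (\<forall>y\<in>V. \<not> p i y)"
  proof (rule compactin_local_to_global[OF closedin_compact_space[OF T U],
        where \<Phi> = "\<lambda>W. \<exists>i\<in>J. (\<forall>x\<in>W \<inter> topspace T. p i x) \<and> (\<forall>y\<in>V. \<not> p i y)"])
    show "\<exists>i\<in>J. (\<forall>x\<in>{} \<inter> topspace T. p i x) \<and> (\<forall>y\<in>V. \<not> p i y)"
      using bot Vs by blast
  next
    fix A B
    assume "\<exists>i\<in>J. (\<forall>x\<in>A \<inter> topspace T. p i x) \<and> (\<forall>y\<in>V. \<not> p i y)"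
      "\<exists>i\<in>J. (\<forall>x\<in>B \<inter> topspace T. p i x) \<and> (\<forall>y\<in>V. \<not> p i y)"
    then obtain i j where ij: "i \<in> J" "\<forall>x\<in>A \<inter> topspace T. p i x" "\<forall>y\<in>V. \<not> p i y"
      "j \<in> J" "\<forall>x\<in>B \<inter> topspace T. p j x" "\<forall>y\<in>V. \<not> p j y" by blast
    obtain k where "k \<in> J" "\<forall>x\<in>topspace T. p k x \<longleftrightarrow> p i x \<or> p j x"
      using join[of i j] ij by blast
    with ij Vs show "\<exists>i\<in>J. (\<forall>x\<in>(A \<union> B) \<inter> topspace T. p i x) \<and> (\<forall>y\<in>V. \<not> p i y)"
      by (intro bexI[of _ k]) auto
  next
    fix x assume x: "x \<in> U"
    then obtain i where "i \<in> J" "p i x" "\<forall>y\<in>V. \<not> p i y" using point by blast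
    with op(1)[of i] x Us
    show "\<exists>W. openin T W \<and> x \<in> W \<and> (\<exists>i\<in>J. (\<forall>x\<in>W \<inter> topspace T. p i x) \<and> (\<forall>y\<in>V. \<not> p i y))"
      by (intro exI[of _ "{x \<in> topspace T. p i x}"]) auto
  qed blast
  then show ?thesis using Us by blast
qed


section \<open>Double Ockham spaces and their morphisms into \<open>N\<close>\<close>

abbreviation NN_struct :: "(N \<times> N) tstruct" where
  "NN_struct \<equiv> struct_prod N_struct N_struct"

abbreviation double_ockham :: "'x tstruct \<Rightarrow> bool" where
  "double_ockham X \<equiv> double_ockham_space (tp X) (rel X) (op1 X) (op2 X)"

definition clopen_upset :: "'x tstruct \<Rightarrow> ('x \<Rightarrow> bool) \<Rightarrow> bool" where
  "clopen_upset X U \<longleftrightarrow> clopenp (tp X) U \<and>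
     (\<forall>x\<in>univ X. \<forall>y\<in>univ X. rel X x y \<longrightarrow> U x \<longrightarrow> U y)"

text \<open>The separation axiom of Priestley spaces restated with clopen up-set predicates, the form in which
  it is used from here on.\<close>

lemma double_ockham_iff:
  "double_ockham X \<longleftrightarrow>
     compact_space (tp X) \<and>
     (\<forall>x\<in>univ X. rel X x x) \<and>
     (\<forall>x\<in>univ X. \<forall>y\<in>univ X. rel X x y \<and> rel X y x \<longrightarrow> x = y) \<and>
     (\<forall>x\<in>univ X. \<forall>y\<in>univ X. \<forall>z\<in>univ X. rel X x y \<and> rel X y z \<longrightarrow> rel X x z) \<and>
     (\<forall>x\<in>univ X. \<forall>y\<in>univ X. \<not> rel X x y \<longrightarrow> (\<exists>U. clopen_upset X U \<and> U x \<and> \<not> U y)) \<and>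
     continuous_map (tp X) (tp X) (op1 X) \<and> continuous_map (tp X) (tp X) (op2 X) \<and>
     (\<forall>x\<in>univ X. \<forall>y\<in>univ X. rel X x y \<longrightarrow>
        rel X (op1 X y) (op1 X x) \<and> rel X (op2 X y) (op2 X x))"
proof -
  have "(\<exists>U. openin (tp X) U \<and> closedin (tp X) U \<and>
           (\<forall>v\<in>U. \<forall>w\<in>univ X. rel X v w \<longrightarrow> w \<in> U) \<and> x \<in> U \<and> y \<notin> U) \<longleftrightarrow>
        (\<exists>U. clopen_upset X U \<and> U x \<and> \<not> U y)" (is "?L \<longleftrightarrow> ?R")
    if xy: "x \<in> univ X" "y \<in> univ X" for x y
  proof
    assume ?L
    then obtain U where U: "openin (tp X) U" "closedin (tp X) U"
      "\<forall>v\<in>U. \<forall>w\<in>univ X. rel X v w \<longrightarrow> w \<in> U" "x \<in> U" "y \<notin> U" by blast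
    have "{x \<in> univ X. x \<in> U} = U" using closedin_subset[OF U(2)] by blast
    with U have "clopen_upset X (\<lambda>x. x \<in> U)" by (auto simp: clopen_upset_def clopenp_def)
    with U show ?R by blast
  next
    assume ?R
    then obtain U where "clopen_upset X U" "U x" "\<not> U y" by blast
    with xy show ?L
      by (intro exI[of _ "{x \<in> univ X. U x}"]) (auto simp: clopen_upset_def clopenp_def)
  qed
  then have "(\<forall>x\<in>univ X. \<forall>y\<in>univ X. \<not> rel X x y \<longrightarrow> (\<exists>U. openin (tp X) U \<and> closedin (tp X) U \<and>
           (\<forall>v\<in>U. \<forall>w\<in>univ X. rel X v w \<longrightarrow> w \<in> U) \<and> x \<in> U \<and> y \<notin> U)) \<longleftrightarrow>
        (\<forall>x\<in>univ X. \<forall>y\<in>univ X. \<not> rel X x y \<longrightarrow> (\<exists>U. clopen_upset X U \<and> U x \<and> \<not> U y))"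
    by simp
  then show ?thesis
    unfolding double_ockham_space_def priestley_space_def by argo
qed

lemma
  assumes "double_ockham X"
  shows double_ockham_compact: "compact_space (tp X)"
    and double_ockham_refl: "x \<in> univ X \<Longrightarrow> rel X x x"
    and double_ockham_antisym: "x \<in> univ X \<Longrightarrow> y \<in> univ X \<Longrightarrow> rel X x y \<Longrightarrow> rel X y x \<Longrightarrow> x = y"
    and double_ockham_trans:
      "x \<in> univ X \<Longrightarrow> y \<in> univ X \<Longrightarrow> z \<in> univ X \<Longrightarrow> rel X x y \<Longrightarrow> rel X y z \<Longrightarrow> rel X x z"
    and double_ockham_separation:
      "x \<in> univ X \<Longrightarrow> y \<in> univ X \<Longrightarrow> \<not> rel X x y \<Longrightarrow> \<exists>U. clopen_upset X U \<and> U x \<and> \<not> U y"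
    and double_ockham_continuous:
      "continuous_map (tp X) (tp X) (op1 X)" "continuous_map (tp X) (tp X) (op2 X)"
    and double_ockham_antitone:
      "x \<in> univ X \<Longrightarrow> y \<in> univ X \<Longrightarrow> rel X x y \<Longrightarrow> rel X (op1 X y) (op1 X x)"
      "x \<in> univ X \<Longrightarrow> y \<in> univ X \<Longrightarrow> rel X x y \<Longrightarrow> rel X (op2 X y) (op2 X x)"
  using assms unfolding double_ockham_iff by blast+

lemma clopen_upset_pullback:
  assumes "continuous_map (tp X) (tp Y) f"
    and "\<And>x y. x \<in> univ X \<Longrightarrow> y \<in> univ X \<Longrightarrow> rel X x y \<Longrightarrow> rel Y (f x) (f y)"
    and "clopen_upset Y U"
  shows "clopen_upset X (\<lambda>x. U (f x))"
  using assms clopenp_compose[OF assms(1)] continuous_map_funspace[OF assms(1)]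
  unfolding clopen_upset_def by blast

lemma topspace_N_struct [simp]: "univ N_struct = UNIV"
  by (simp add: N_struct_def)

lemma topspace_NN_struct [simp]: "univ NN_struct = UNIV"
  by (simp add: struct_prod_def)

lemma N_struct_simps [simp]:
  "rel N_struct a b \<longleftrightarrow> (\<forall>s. (even (length s) \<longrightarrow> a s \<longrightarrow> b s) \<and> (odd (length s) \<longrightarrow> b s \<longrightarrow> a s))"
  "op1 N_struct a s = a (e1 # s)" "op2 N_struct a s = a (e2 # s)"
  by (auto simp: N_struct_def)

lemma NN_struct_simps [simp]:
  "rel NN_struct a b \<longleftrightarrow> rel N_struct (fst a) (fst b) \<and> rel N_struct (snd a) (snd b)"
  "fst (op1 NN_struct a) = op1 N_struct (fst a)" "snd (op1 NN_struct a) = op1 N_struct (snd a)"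
  "fst (op2 NN_struct a) = op2 N_struct (fst a)" "snd (op2 NN_struct a) = op2 N_struct (snd a)"
  by (simp_all add: struct_prod_def)

lemma continuous_into_N:
  "continuous_map T (tp N_struct) f \<longleftrightarrow> (\<forall>s. clopenp T (\<lambda>x. f x s))"
  by (simp add: N_struct_def continuous_map_componentwise_UNIV continuous_map_into_discrete_bool)

lemma continuous_into_NN:
  "continuous_map T (tp NN_struct) f \<longleftrightarrow>
     (\<forall>s. clopenp T (\<lambda>x. fst (f x) s) \<and> clopenp T (\<lambda>x. snd (f x) s))"
  by (auto simp: struct_prod_def continuous_map_pairwise continuous_into_N)

lemma clopenp_N: "clopenp (tp N_struct) (\<lambda>a. a s)"
  using continuous_into_N[of "tp N_struct" "\<lambda>a. a"] by simp

lemma clopenp_NN: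
  "clopenp (tp NN_struct) (\<lambda>a. fst a s)" "clopenp (tp NN_struct) (\<lambda>a. snd a s)"
  using continuous_into_NN[of "tp NN_struct" "\<lambda>a. a"] by simp_all

lemma Hausdorff_N: "Hausdorff_space (tp N_struct)"
  by (simp add: N_struct_def Hausdorff_space_product_topology)

lemma Hausdorff_NN: "Hausdorff_space (tp NN_struct)"
  using Hausdorff_N by (simp add: struct_prod_def Hausdorff_space_prod_topology)

lemma compact_N: "compact_space (tp N_struct)"
  by (simp add: N_struct_def compact_space_product_topology compact_space_discrete_topology)

lemma compact_NN: "compact_space (tp NN_struct)"
  using compact_N by (simp add: struct_prod_def compact_space_prod_topology)

text \<open>Evaluation at a word of even length is an up-set, and at a word of odd length its complement is.
  These sub-basic up-sets witness that \<open>N\<close> is a Priestley space.\<close>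

lemma clopen_upset_N:
  "clopen_upset N_struct (\<lambda>a. a s \<longleftrightarrow> even (length s))"
  by (auto simp: clopen_upset_def clopenp_N intro!: clopenp_iff clopenp_const)

lemma double_ockham_N: "double_ockham N_struct"
proof -
  have "\<exists>U. clopen_upset N_struct U \<and> U a \<and> \<not> U b" if "\<not> rel N_struct a b" for a b
  proof -
    from that obtain s where
      "a s \<longleftrightarrow> even (length s)" "\<not> (b s \<longleftrightarrow> even (length s))"
      by auto
    then show ?thesis using clopen_upset_N[of s] by blast
  qed
  moreover have "a = b" if "rel N_struct a b" "rel N_struct b a" for a b
  proof
    fix s show "a s = b s" using that by (cases "even (length s)") auto
  qed
  moreover have "rel N_struct a c" if "rel N_struct a b" "rel N_struct b c" for a b c
    using that unfolding N_struct_simps(1) by blast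
  moreover have "rel N_struct (op1 N_struct b) (op1 N_struct a) \<and>
      rel N_struct (op2 N_struct b) (op2 N_struct a)" if "rel N_struct a b" for a b
    using that by auto
  moreover have "rel N_struct a a" for a
    by auto
  ultimately show ?thesis
    unfolding double_ockham_iff
    by (intro conjI)
      (simp_all add: compact_N continuous_into_N clopenp_N del: N_struct_simps(1), blast+)
qed


lemma double_ockham_NN: "double_ockham NN_struct"
proof -
  have cont: "continuous_map (tp NN_struct) (tp N_struct) fst"
    "continuous_map (tp NN_struct) (tp N_struct) snd"
    by (simp_all add: continuous_into_N clopenp_NN)
  have "\<exists>U. clopen_upset NN_struct U \<and> U a \<and> \<not> U b" if "\<not> rel NN_struct a b" for a b
  proof -
    have "\<not> rel N_struct (fst a) (fst b) \<or> \<not> rel N_struct (snd a) (snd b)"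
      using that NN_struct_simps(1) by blast
    then show ?thesis
    proof
      assume "\<not> rel N_struct (fst a) (fst b)"
      then obtain U where U: "clopen_upset N_struct U" "U (fst a)" "\<not> U (fst b)"
        using double_ockham_separation[OF double_ockham_N, of "fst a" "fst b"]
        by (auto simp del: N_struct_simps(1))
      have "clopen_upset NN_struct (\<lambda>a. U (fst a))"
        using NN_struct_simps(1) by (intro clopen_upset_pullback[OF cont(1) _ U(1)]) blast
      then show ?thesis
        using U by (intro exI[of _ "\<lambda>a. U (fst a)"]) simp
    next
      assume "\<not> rel N_struct (snd a) (snd b)"
      then obtain U where U: "clopen_upset N_struct U" "U (snd a)" "\<not> U (snd b)"
        using double_ockham_separation[OF double_ockham_N, of "snd a" "snd b"]
        by (auto simp del: N_struct_simps(1))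
      have "clopen_upset NN_struct (\<lambda>a. U (snd a))"
        using NN_struct_simps(1) by (intro clopen_upset_pullback[OF cont(2) _ U(1)]) blast
      then show ?thesis
        using U by (intro exI[of _ "\<lambda>a. U (snd a)"]) simp
    qed
  qed
  moreover have "a = b" if "rel NN_struct a b" "rel NN_struct b a" for a b
    using that double_ockham_antisym[OF double_ockham_N]
    unfolding NN_struct_simps(1) topspace_N_struct by (intro prod_eqI) blast+
  moreover have "rel NN_struct a c" if "rel NN_struct a b" "rel NN_struct b c" for a b c
    using that double_ockham_trans[OF double_ockham_N]
    unfolding NN_struct_simps(1) topspace_N_struct by blast
  moreover have "rel NN_struct (op1 NN_struct b) (op1 NN_struct a) \<and>
      rel NN_struct (op2 NN_struct b) (op2 NN_struct a)" if "rel NN_struct a b" for a b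
    using that double_ockham_antitone[OF double_ockham_N]
    unfolding NN_struct_simps topspace_N_struct by blast
  moreover have "rel NN_struct a a" for a
    by auto
  ultimately show ?thesis
    unfolding double_ockham_iff
    by (intro conjI)
      (simp_all add: compact_NN continuous_into_NN clopenp_NN del: NN_struct_simps(1), blast+)
qed

text \<open>The action of words on a structure. The first letter acts first, which matches the operations of
  \<open>N\<close>: these delete a first letter.\<close>

fun act :: "'x tstruct \<Rightarrow> letter list \<Rightarrow> 'x \<Rightarrow> 'x" where
  "act X [] x = x"
| "act X (e1 # s) x = act X s (op1 X x)"
| "act X (e2 # s) x = act X s (op2 X x)"

lemma act_in_univ: "wf_struct X \<Longrightarrow> x \<in> univ X \<Longrightarrow> act X s x \<in> univ X"
  by (induction X s x rule: act.induct) (auto simp: wf_struct_def)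

lemma act_mor:
  assumes "\<alpha> \<in> mor X Y" "wf_struct X" "x \<in> univ X"
  shows "\<alpha> (act X s x) = act Y s (\<alpha> x)"
  using assms(3)
proof (induction s arbitrary: x)
  case (Cons e s)
  then have "op1 X x \<in> univ X" "op2 X x \<in> univ X"
    using assms(2) by (auto simp: wf_struct_def)
  with Cons assms(1) show ?case
    by (cases e) (auto simp: mor_def)
qed simp

lemma act_N: "act N_struct s a t = a (s @ t)"
proof (induction s arbitrary: a)
  case (Cons e s)
  then show ?case by (cases e) simp_all
qed simp

text \<open>The reason that a morphism into \<open>N\<close> is determined by one clopen up-set: it commutes with the
  action of \<open>s\<close>, and in \<open>N\<close> this action brings the value at \<open>s\<close> to the empty word.\<close>

lemma mor_N_eq:
  assumes "\<alpha> \<in> mor X N_struct" "wf_struct X" "x \<in> univ X"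
  shows "\<alpha> x s \<longleftrightarrow> \<alpha> (act X s x) []"
  using act_mor[OF assms, of s] act_N[of s "\<alpha> x" "[]"] by simp

lemma double_ockham_imp_wf: "double_ockham X \<Longrightarrow> wf_struct X"
  using double_ockham_continuous continuous_map_funspace unfolding wf_struct_def by blast

lemma act_mono:
  assumes X: "double_ockham X" and xy: "x \<in> univ X" "y \<in> univ X" "rel X x y"
  shows "if even (length s) then rel X (act X s x) (act X s y)
         else rel X (act X s y) (act X s x)"
  using xy
proof (induction s arbitrary: x y)
  case (Cons e s)
  have in_univ: "op1 X z \<in> univ X" "op2 X z \<in> univ X" if "z \<in> univ X" for z
    using double_ockham_imp_wf[OF X] that by (auto simp: wf_struct_def)
  have "rel X (op1 X y) (op1 X x)" "rel X (op2 X y) (op2 X x)"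
    using double_ockham_antitone[OF X] Cons.prems by blast+
  then show ?case
    using Cons.IH[of "op1 X y" "op1 X x"] Cons.IH[of "op2 X y" "op2 X x"] in_univ Cons.prems
    by (cases e) auto
qed simp

lemma continuous_act:
  assumes "double_ockham X"
  shows "continuous_map (tp X) (tp X) (act X s)"
proof (induction s)
  case Nil
  have "act X [] = id" by auto
  then show ?case by simp
next
  case (Cons e s)
  have "act X (e1 # s) = act X s \<circ> op1 X" "act X (e2 # s) = act X s \<circ> op2 X"
    by auto
  moreover have "continuous_map (tp X) (tp X) (op1 X)" "continuous_map (tp X) (tp X) (op2 X)"
    using double_ockham_continuous[OF assms] .
  ultimately show ?case
    using Cons by (cases e) (simp_all only: continuous_map_compose)
qed

text \<open>The morphism that corresponds to the clopen up-set \<open>U\<close>; it records which points of the orbit of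
  \<open>x\<close> lie in \<open>U\<close>.\<close>

definition orbit_map :: "'x tstruct \<Rightarrow> ('x \<Rightarrow> bool) \<Rightarrow> 'x \<Rightarrow> N" where
  "orbit_map X U = (\<lambda>x\<in>univ X. \<lambda>s. U (act X s x))"

lemma orbit_map_mor:
  assumes X: "double_ockham X" and U: "clopen_upset X U"
  shows "orbit_map X U \<in> mor X N_struct"
proof -
  have wf: "wf_struct X" using X by (rule double_ockham_imp_wf)
  have op: "op1 X x \<in> univ X" "op2 X x \<in> univ X" if "x \<in> univ X" for x
    using wf that by (auto simp: wf_struct_def)
  have "continuous_map (tp X) (tp N_struct) (\<lambda>x s. U (act X s x))"
    using clopenp_compose[OF continuous_act[OF X]] U
    by (simp add: continuous_into_N clopen_upset_def)
  then have "continuous_map (tp X) (tp N_struct) (orbit_map X U)"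
    by (rule continuous_map_eq) (simp add: orbit_map_def)
  moreover have "rel N_struct (orbit_map X U x) (orbit_map X U y)"
    if "x \<in> univ X" "y \<in> univ X" "rel X x y" for x y
    using act_mono[OF X that] act_in_univ[OF wf that(1)] act_in_univ[OF wf that(2)] U that
    unfolding N_struct_simps clopen_upset_def orbit_map_def restrict_apply'[OF that(1)]
      restrict_apply'[OF that(2)] by metis
  moreover have "orbit_map X U (op1 X x) = op1 N_struct (orbit_map X U x)"
    "orbit_map X U (op2 X x) = op2 N_struct (orbit_map X U x)" if "x \<in> univ X" for x
    using that op[OF that] by (auto simp: orbit_map_def fun_eq_iff)
  ultimately show ?thesis
    by (simp add: mor_def orbit_map_def)
qed

lemma mor_N_upset:
  assumes "\<alpha> \<in> mor X N_struct"
  shows "clopen_upset X (\<lambda>x. \<alpha> x [])"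
proof -
  have "clopenp (tp X) (\<lambda>x. \<alpha> x [])"
    using assms continuous_into_N by (auto simp: mor_def)
  moreover have "\<alpha> x [] \<longrightarrow> \<alpha> y []" if "x \<in> univ X" "y \<in> univ X" "rel X x y" for x y
    using assms that by (force simp: mor_def dest!: spec[of _ "[]"])
  ultimately show ?thesis by (auto simp: clopen_upset_def)
qed

lemma mor_NN_iff:
  assumes "wf_struct X"
  shows "f \<in> mor X NN_struct \<longleftrightarrow> f \<in> extensional (univ X) \<and>
     (\<lambda>x\<in>univ X. fst (f x)) \<in> mor X N_struct \<and> (\<lambda>x\<in>univ X. snd (f x)) \<in> mor X N_struct"
proof -
  have op: "op1 X x \<in> univ X" "op2 X x \<in> univ X" if "x \<in> univ X" for x
    using assms that by (auto simp: wf_struct_def)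
  have c: "clopenp (tp X) (\<lambda>x. (\<lambda>x\<in>univ X. h x) x s) \<longleftrightarrow> clopenp (tp X) (\<lambda>x. h x s)" for h :: "_ \<Rightarrow> N" and s
    by (rule clopenp_cong) simp
  show ?thesis
    unfolding mor_def mem_Collect_eq continuous_into_NN continuous_into_N c
    by (auto simp: prod_eq_iff op simp del: N_struct_simps)
qed

definition pair_map :: "'x tstruct \<Rightarrow> ('x \<Rightarrow> N) \<Rightarrow> ('x \<Rightarrow> N) \<Rightarrow> 'x \<Rightarrow> N \<times> N" where
  "pair_map X \<alpha> \<beta> = (\<lambda>x\<in>univ X. (\<alpha> x, \<beta> x))"

lemma pair_map_mor:
  assumes "wf_struct X" "\<alpha> \<in> mor X N_struct" "\<beta> \<in> mor X N_struct"
  shows "pair_map X \<alpha> \<beta> \<in> mor X NN_struct"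
proof -
  have "(\<lambda>x\<in>univ X. fst (pair_map X \<alpha> \<beta> x)) = \<alpha>" "(\<lambda>x\<in>univ X. snd (pair_map X \<alpha> \<beta> x)) = \<beta>"
    using assms(2,3) by (auto simp: mor_def pair_map_def extensional_def fun_eq_iff)
  then show ?thesis
    using assms by (simp add: mor_NN_iff) (simp add: pair_map_def)
qed

lemma mor_NN_components:
  assumes "wf_struct X" "\<alpha> \<in> mor X NN_struct"
  shows "(\<lambda>x\<in>univ X. fst (\<alpha> x)) \<in> mor X N_struct" "(\<lambda>x\<in>univ X. snd (\<alpha> x)) \<in> mor X N_struct"
  using assms mor_NN_iff by blast+

lemma mor_NN_eq:
  assumes "\<alpha> \<in> mor X NN_struct" "wf_struct X" "x \<in> univ X"
  shows "fst (\<alpha> x) s \<longleftrightarrow> fst (\<alpha> (act X s x)) []" "snd (\<alpha> x) s \<longleftrightarrow> snd (\<alpha> (act X s x)) []"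
  using mor_N_eq[OF mor_NN_components(1)[OF assms(2,1)] assms(2,3), of s]
    mor_N_eq[OF mor_NN_components(2)[OF assms(2,1)] assms(2,3), of s]
    act_in_univ[OF assms(2,3)] assms(3) by simp_all

lemma clopen_upset_cong:
  "(\<And>x. x \<in> univ X \<Longrightarrow> U x \<longleftrightarrow> V x) \<Longrightarrow> clopen_upset X U \<longleftrightarrow> clopen_upset X V"
  using clopenp_cong[of "tp X" U V] by (simp add: clopen_upset_def)

lemma mor_NN_upset:
  assumes "wf_struct X" "\<alpha> \<in> mor X NN_struct"
  shows "clopen_upset X (\<lambda>x. fst (\<alpha> x) [])" "clopen_upset X (\<lambda>x. snd (\<alpha> x) [])"
proof -
  have "clopen_upset X (\<lambda>x. (\<lambda>x\<in>univ X. fst (\<alpha> x)) x [])" "clopen_upset X (\<lambda>x. (\<lambda>x\<in>univ X. snd (\<alpha> x)) x [])"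
    using mor_NN_components[OF assms] mor_N_upset by blast+
  then show "clopen_upset X (\<lambda>x. fst (\<alpha> x) [])" "clopen_upset X (\<lambda>x. snd (\<alpha> x) [])"
    by (simp_all cong: clopen_upset_cong)
qed


section \<open>The dual category\<close>

text \<open>Order, topology and operations of \<open>X\<close> are computed coordinatewise along the embedding \<open>f\<close>, so each
  axiom passes from \<open>S\<close> to \<open>X\<close>. A clopen up-set of \<open>S\<close> pulled back along one coordinate separates
  the points of \<open>X\<close>, and continuity of the operations is transported by the inverse \<open>g\<close> of \<open>f\<close>.\<close>

lemma double_ockham_if_IScP_plus:
  fixes S :: "'s tstruct" and X :: "'x tstruct"
  assumes S: "double_ockham S" and X: "in_IScP_plus S X"
  shows "double_ockham X"
proof -
  obtain I :: "('x \<Rightarrow> 's) set" and Y f where Y: "closed_subuniverse (struct_power S I) Y"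
    and f: "f \<in> struct_iso X (restrict_struct (struct_power S I) Y)"
    using X unfolding in_IScP_plus_def by blast
  let ?P = "struct_power S I" and ?Q = "subtopology (product_topology (\<lambda>_. tp S) I) Y"
  note compS = double_ockham_compact[OF S] and reflS = double_ockham_refl[OF S]
    and antisymS = double_ockham_antisym[OF S] and transS = double_ockham_trans[OF S]
    and sepS = double_ockham_separation[OF S] and contS = double_ockham_continuous[OF S]
    and antiS = double_ockham_antitone[OF S]
  have uP: "univ ?P = I \<rightarrow>\<^sub>E univ S"
    by (simp add: struct_power_def)
  have YP: "Y \<subseteq> I \<rightarrow>\<^sub>E univ S"
    using Y closedin_subset uP unfolding closed_subuniverse_def by blast
  have hom: "homeomorphic_map (tp X) ?Q f"
    using f by (simp add: struct_iso_def restrict_struct_def struct_power_def)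
  then obtain g where g: "homeomorphic_maps (tp X) ?Q f g"
    by (auto simp: homeomorphic_map_maps)
  have fY: "f x \<in> Y" if "x \<in> univ X" for x
    using homeomorphic_imp_surjective_map[OF hom] that by auto
  have fS: "f x i \<in> univ S" if "x \<in> univ X" "i \<in> I" for x i
    using fY[OF that(1)] YP that(2) by blast
  have frel: "rel X x y \<longleftrightarrow> (\<forall>i\<in>I. rel S (f x i) (f y i))" if "x \<in> univ X" "y \<in> univ X" for x y
    using f that unfolding struct_iso_def mor_def
    by (auto simp: restrict_struct_def struct_power_def)
  have fop: "f (op1 X x) = (\<lambda>i\<in>I. op1 S (f x i))" "f (op2 X x) = (\<lambda>i\<in>I. op2 S (f x i))"
    and wf: "op1 X x \<in> univ X" "op2 X x \<in> univ X" if "x \<in> univ X" for x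
    using f that unfolding struct_iso_def mor_def wf_struct_def
    by (auto simp: restrict_struct_def struct_power_def)
  have fcont: "continuous_map (tp X) (tp S) (\<lambda>x. f x i)" if "i \<in> I" for i
    using homeomorphic_imp_continuous_map[OF hom] that
    by (auto simp: continuous_map_in_subtopology continuous_map_componentwise)
  have inj: "x = y" if "x \<in> univ X" "y \<in> univ X" "\<And>i. i \<in> I \<Longrightarrow> f x i = f y i" for x y
  proof -
    have "f x = f y"
      using fY[OF that(1)] fY[OF that(2)] YP that(3) by (intro PiE_ext[of _ I "\<lambda>_. univ S"]) auto
    then show ?thesis
      using g that(1,2) unfolding homeomorphic_maps_def by metis
  qed
  have "compact_space ?Q"
    using Y compS by (intro compact_space_subtopology closedin_compact_space)
      (auto simp: closed_subuniverse_def struct_power_def compact_space_product_topology)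
  then have comp: "compact_space (tp X)"
    using homeomorphic_compact_space homeomorphic_map_imp_homeomorphic_space[OF hom] by blast
  have sep: "\<exists>U. clopen_upset X U \<and> U x \<and> \<not> U y"
    if xy: "x \<in> univ X" "y \<in> univ X" "\<not> rel X x y" for x y
  proof -
    obtain i where i: "i \<in> I" "\<not> rel S (f x i) (f y i)" using frel xy by blast
    then obtain U where U: "clopen_upset S U" "U (f x i)" "\<not> U (f y i)"
      using sepS[OF fS[OF xy(1)] fS[OF xy(2)]] by blast
    have "clopen_upset X (\<lambda>x. U (f x i))"
      using frel i(1) by (intro clopen_upset_pullback[OF fcont[OF i(1)] _ U(1)]) blast
    with U show ?thesis by blast
  qed
  have gcont: "continuous_map (tp X) (tp X) u"
    if u: "\<And>x. x \<in> univ X \<Longrightarrow> u x \<in> univ X" "\<And>x. x \<in> univ X \<Longrightarrow> f (u x) = (\<lambda>i\<in>I. v (f x i))"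
      and v: "continuous_map (tp S) (tp S) v" for u v
  proof -
    have "continuous_map (tp X) (product_topology (\<lambda>_. tp S) I) (\<lambda>x. \<lambda>i\<in>I. v (f x i))"
      using continuous_map_compose[OF fcont v] by (auto simp: continuous_map_componentwise o_def)
    then have "continuous_map (tp X) (product_topology (\<lambda>_. tp S) I) (\<lambda>x. f (u x))"
      by (rule continuous_map_eq) (simp add: u(2))
    then have "continuous_map (tp X) ?Q (\<lambda>x. f (u x))"
      using fY u(1) by (auto simp: continuous_map_in_subtopology)
    then have "continuous_map (tp X) (tp X) (\<lambda>x. g (f (u x)))"
      using g continuous_map_compose[of "tp X" ?Q "\<lambda>x. f (u x)" "tp X" g]
      by (auto simp: homeomorphic_maps_def o_def)
    then show ?thesis
      by (rule continuous_map_eq) (use g u(1) in \<open>auto simp: homeomorphic_maps_def\<close>)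
  qed
  show ?thesis
    unfolding double_ockham_iff
  proof (intro conjI ballI impI)
    fix x y assume xy: "x \<in> univ X" "y \<in> univ X" "rel X x y \<and> rel X y x"
    show "x = y"
    proof (rule inj[OF xy(1,2)])
      fix i assume i: "i \<in> I"
      show "f x i = f y i"
        using xy i frel by (intro antisymS fS) blast+
    qed
  next
    fix x y z assume xyz: "x \<in> univ X" "y \<in> univ X" "z \<in> univ X" "rel X x y \<and> rel X y z"
    have "rel S (f x i) (f z i)" if i: "i \<in> I" for i
      using transS[OF fS[OF xyz(1) i] fS[OF xyz(2) i] fS[OF xyz(3) i]] xyz i frel by blast
    then show "rel X x z" using frel xyz by blast
  next
    fix x y assume xy: "x \<in> univ X" "y \<in> univ X" and "rel X x y"
    then have "rel S (f x i) (f y i)" if "i \<in> I" for i using frel that by blast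
    then have "rel S (op1 S (f y i)) (op1 S (f x i))" "rel S (op2 S (f y i)) (op2 S (f x i))"
      if "i \<in> I" for i using antiS fS xy that by blast+
    then show "rel X (op1 X y) (op1 X x)" "rel X (op2 X y) (op2 X x)"
      using xy by (auto simp: frel fop wf)
  next
    fix x assume "x \<in> univ X"
    then show "rel X x x" using frel reflS fS by blast
  next
    show "continuous_map (tp X) (tp X) (op1 X)" "continuous_map (tp X) (tp X) (op2 X)"
      using wf fop contS by (blast intro: gcont)+
  qed (use comp sep in auto)
qed

lemma
  assumes "closed_subuniverse P Y"
  shows univ_closed_substructure: "univ (restrict_struct P Y) = Y"
    and wf_closed_substructure: "wf_struct (restrict_struct P Y)"
proof -
  show u: "univ (restrict_struct P Y) = Y"
    using assms closedin_subset by (auto simp: closed_subuniverse_def restrict_struct_def)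
  show "wf_struct (restrict_struct P Y)"
    using assms unfolding wf_struct_def u by (simp add: closed_subuniverse_def restrict_struct_def)
qed

text \<open>The power to use is the one indexed by all morphisms into \<open>S\<close>. By Priestley separation the
  hypothesis \<open>rep\<close> makes evaluation reflect the order, hence injective; as a continuous injection of
  a compact space into a Hausdorff space it is an embedding with closed image.\<close>

lemma IScP_plus_if_represents_upsets:
  fixes X :: "'x tstruct" and S :: "'s tstruct"
  assumes X: "double_ockham X" and S: "double_ockham S" and H: "Hausdorff_space (tp S)"
    and rep: "\<And>U. clopen_upset X U \<Longrightarrow> \<exists>\<alpha>\<in>mor X S. \<forall>x\<in>univ X. \<forall>y\<in>univ X. rel S (\<alpha> x) (\<alpha> y) \<longrightarrow> U x \<longrightarrow> U y"
  shows "in_IScP_plus S X"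
proof -
  note comp = double_ockham_compact[OF X] and wf = double_ockham_imp_wf[OF X]
    and anti = double_ockham_antisym[OF X] and refl = double_ockham_refl[OF S]
  have ne: "mor X S \<noteq> {}"
    using rep[of "\<lambda>x. True"] by (auto simp: clopen_upset_def clopenp_const)
  have sep: "rel X x y"
    if "x \<in> univ X" "y \<in> univ X" "\<forall>\<alpha>\<in>mor X S. rel S (\<alpha> x) (\<alpha> y)" for x y
    using double_ockham_separation[OF X that(1,2)] rep that by blast
  let ?I = "mor X S" and ?P = "struct_power S (mor X S)"
  define e where "e = (\<lambda>x\<in>univ X. \<lambda>\<alpha>\<in>?I. \<alpha> x)"
  let ?Y = "e ` univ X"
  have op: "op1 X x \<in> univ X" "op2 X x \<in> univ X" if "x \<in> univ X" for x
    using wf that by (auto simp: wf_struct_def)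
  have morop: "\<alpha> (op1 X x) = op1 S (\<alpha> x)" "\<alpha> (op2 X x) = op2 S (\<alpha> x)"
    if "\<alpha> \<in> ?I" "x \<in> univ X" for \<alpha> x
    using that by (simp_all add: mor_def)
  have inS: "\<alpha> x \<in> univ S" if "\<alpha> \<in> ?I" "x \<in> univ X" for \<alpha> x
    using that continuous_map_funspace by (auto simp: mor_def)
  have "continuous_map (tp X) (tp ?P) (\<lambda>x. \<lambda>\<alpha>\<in>?I. \<alpha> x)"
    by (auto simp: struct_power_def continuous_map_componentwise mor_def)
  then have cont: "continuous_map (tp X) (tp ?P) e"
    by (rule continuous_map_eq) (simp add: e_def)
  have eext: "e \<in> extensional (univ X)"
    by (simp add: e_def)
  have HP: "Hausdorff_space (tp ?P)"
    using H by (simp add: struct_power_def Hausdorff_space_product_topology)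
  have "compactin (tp ?P) ?Y"
    using image_compactin[OF _ cont] comp by (simp add: compact_space_def)
  then have closed: "closedin (tp ?P) ?Y"
    using HP compactin_imp_closedin by blast
  then have Ysub: "?Y \<subseteq> univ ?P"
    by (rule closedin_subset)
  have eop: "e (op1 X x) = op1 ?P (e x)" "e (op2 X x) = op2 ?P (e x)" if "x \<in> univ X" for x
    using that op[OF that] morop by (auto simp: e_def struct_power_def intro!: restrict_ext)
  have cs: "closed_subuniverse ?P ?Y"
    using closed eop op by (auto simp: closed_subuniverse_def simp flip: eop)
  have erel: "rel ?P (e x) (e y) \<longleftrightarrow> rel X x y" if xy: "x \<in> univ X" "y \<in> univ X" for x y
  proof
    assume "rel ?P (e x) (e y)"
    then show "rel X x y" using sep[OF xy] xy by (simp add: struct_power_def e_def)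
  next
    assume "rel X x y"
    then show "rel ?P (e x) (e y)" using xy by (auto simp: struct_power_def e_def mor_def)
  qed
  have inj: "inj_on e (univ X)"
  proof
    fix x y assume xy: "x \<in> univ X" "y \<in> univ X" and "e x = e y"
    moreover have "rel ?P (e x) (e x)"
      using refl inS xy by (simp add: struct_power_def e_def)
    ultimately show "x = y" using erel anti by metis
  qed
  have "homeomorphic_map (tp X) (subtopology (tp ?P) ?Y) e"
  proof (rule continuous_imp_homeomorphic_map)
    show "continuous_map (tp X) (subtopology (tp ?P) ?Y) e"
      using cont by (simp add: continuous_map_in_subtopology)
    show "Hausdorff_space (subtopology (tp ?P) ?Y)"
      using HP by (rule Hausdorff_space_subtopology)
    show "e ` univ X = topspace (subtopology (tp ?P) ?Y)"
      using Ysub by auto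
  qed (fact comp inj)+
  moreover from this have "e \<in> mor X (restrict_struct ?P ?Y)"
    using eop erel homeomorphic_imp_continuous_map unfolding mor_def[of X "restrict_struct ?P ?Y"]
    by (auto simp: restrict_struct_def eext)
  moreover have "wf_struct (restrict_struct ?P ?Y)"
    using cs by (rule wf_closed_substructure)
  ultimately have "e \<in> struct_iso X (restrict_struct ?P ?Y)"
    using erel wf by (simp add: struct_iso_def restrict_struct_def)
  then show ?thesis
    by (rule in_IScP_plusI[OF ne cs])
qed

lemma IScP_plus_N_iff: "in_IScP_plus N_struct X \<longleftrightarrow> double_ockham X"
proof
  show "in_IScP_plus N_struct X \<Longrightarrow> double_ockham X"
    using double_ockham_if_IScP_plus[OF double_ockham_N] .
  assume X: "double_ockham X"
  show "in_IScP_plus N_struct X"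
  proof (rule IScP_plus_if_represents_upsets[OF X double_ockham_N Hausdorff_N])
    fix U assume U: "clopen_upset X U"
    show "\<exists>\<alpha>\<in>mor X N_struct. \<forall>x\<in>univ X. \<forall>y\<in>univ X. rel N_struct (\<alpha> x) (\<alpha> y) \<longrightarrow> U x \<longrightarrow> U y"
      using orbit_map_mor[OF X U]
      by (rule bexI[rotated]) (auto simp: orbit_map_def dest!: spec[of _ "[]"])
  qed
qed

lemma IScP_plus_NN_iff: "in_IScP_plus NN_struct X \<longleftrightarrow> double_ockham X"
proof
  show "in_IScP_plus NN_struct X \<Longrightarrow> double_ockham X"
    using double_ockham_if_IScP_plus[OF double_ockham_NN] .
  assume X: "double_ockham X"
  show "in_IScP_plus NN_struct X"
  proof (rule IScP_plus_if_represents_upsets[OF X double_ockham_NN Hausdorff_NN])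
    fix U assume U: "clopen_upset X U"
    show "\<exists>\<alpha>\<in>mor X NN_struct. \<forall>x\<in>univ X. \<forall>y\<in>univ X. rel NN_struct (\<alpha> x) (\<alpha> y) \<longrightarrow> U x \<longrightarrow> U y"
      using pair_map_mor[OF double_ockham_imp_wf[OF X] orbit_map_mor[OF X U] orbit_map_mor[OF X U]]
      by (rule bexI[rotated]) (auto simp: pair_map_def orbit_map_def dest!: spec[of _ "[]"])
  qed
qed

lemma mor_NN_reflects_order:
  assumes X: "double_ockham X" and xy: "x \<in> univ X" "y \<in> univ X"
    and le: "\<And>\<alpha>. \<alpha> \<in> mor X NN_struct \<Longrightarrow> fst (\<alpha> x) [] \<longrightarrow> fst (\<alpha> y) []"
  shows "rel X x y"
proof (rule ccontr)
  assume "\<not> rel X x y"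
  then obtain U where U: "clopen_upset X U" "U x" "\<not> U y"
    using double_ockham_separation[OF X xy] by blast
  let ?\<alpha> = "pair_map X (orbit_map X U) (orbit_map X U)"
  have "?\<alpha> \<in> mor X NN_struct"
    using pair_map_mor double_ockham_imp_wf[OF X] orbit_map_mor[OF X U(1)] by blast
  from le[OF this] U xy show False
    by (simp add: pair_map_def orbit_map_def)
qed


section \<open>Injectivity\<close>

text \<open>The images of \<open>U\<close> and of its complement are closed in \<open>Y\<close>, and since \<open>\<phi>\<close> reflects the order no
  point of the first lies below a point of the second. Compactness separates them by a clopen
  up-set of \<open>Y\<close>.\<close>

lemma clopen_upset_extension:
  assumes X: "double_ockham X" and Y: "double_ockham Y" and \<phi>: "\<phi> \<in> embedding X Y"
    and U: "clopen_upset X U"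
  shows "\<exists>V. clopen_upset Y V \<and> (\<forall>x\<in>univ X. V (\<phi> x) \<longleftrightarrow> U x)"
proof -
  let ?Z = "subtopology (tp Y) (\<phi> ` univ X)"
  have hom: "homeomorphic_map (tp X) ?Z \<phi>" and closed: "closedin (tp Y) (\<phi> ` univ X)"
    and refl: "\<And>x y. x \<in> univ X \<Longrightarrow> y \<in> univ X \<Longrightarrow> rel Y (\<phi> x) (\<phi> y) \<Longrightarrow> rel X x y"
    using \<phi> by (auto simp: embedding_def struct_iso_def restrict_struct_def closed_subuniverse_def)
  have \<phi>Y: "\<phi> x \<in> univ Y" if "x \<in> univ X" for x
    using closedin_subset[OF closed] that by blast
  have cl: "closedin (tp Y) (\<phi> ` {x \<in> univ X. P x})" if "clopenp (tp X) P" for P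
  proof -
    have "closedin ?Z (\<phi> ` {x \<in> univ X. P x})"
      using homeomorphic_map_closedness_eq[OF hom] that by (auto simp: clopenp_def)
    then show ?thesis
      using closedin_trans_full[OF _ closed] by blast
  qed
  have Uc: "clopenp (tp X) U" using U by (simp add: clopen_upset_def)
  have "\<exists>V\<in>Collect (clopen_upset Y). (\<forall>y\<in>\<phi> ` {x \<in> univ X. U x}. V y) \<and>
    (\<forall>y\<in>\<phi> ` {x \<in> univ X. \<not> U x}. \<not> V y)"
  proof (rule compact_separation)
    show "closedin (tp Y) (\<phi> ` {x \<in> univ X. U x})" "closedin (tp Y) (\<phi> ` {x \<in> univ X. \<not> U x})"
      using cl Uc clopenp_not[OF Uc] by blast+
  next
    fix y z assume "y \<in> \<phi> ` {x \<in> univ X. U x}" "z \<in> \<phi> ` {x \<in> univ X. \<not> U x}"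
    then obtain x x' where x: "x \<in> univ X" "U x" "y = \<phi> x" "x' \<in> univ X" "\<not> U x'" "z = \<phi> x'"
      by blast
    then have "\<not> rel X x x'" using U by (auto simp: clopen_upset_def)
    then have "\<not> rel Y y z" using refl x by blast
    then show "\<exists>V\<in>Collect (clopen_upset Y). V y \<and> \<not> V z"
      using double_ockham_separation[OF Y] \<phi>Y x by blast
  next
    fix V W assume VW: "V \<in> Collect (clopen_upset Y)" "W \<in> Collect (clopen_upset Y)"
    then have "clopen_upset Y (\<lambda>y. V y \<and> W y)" "clopen_upset Y (\<lambda>y. V y \<or> W y)"
      by (auto simp: clopen_upset_def intro: clopenp_conj clopenp_disj)
    then show "\<exists>K\<in>Collect (clopen_upset Y). \<forall>y\<in>univ Y. K y \<longleftrightarrow> V y \<and> W y"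
      "\<exists>K\<in>Collect (clopen_upset Y). \<forall>y\<in>univ Y. K y \<longleftrightarrow> V y \<or> W y"
      by auto
  next
    have "clopen_upset Y (\<lambda>y. True)" "clopen_upset Y (\<lambda>y. False)"
      by (simp_all add: clopen_upset_def clopenp_const)
    then show "\<exists>K\<in>Collect (clopen_upset Y). \<forall>y\<in>univ Y. K y"
      "\<exists>K\<in>Collect (clopen_upset Y). \<forall>y\<in>univ Y. \<not> K y"
      by auto
  qed (use double_ockham_compact[OF Y] in \<open>auto simp: clopen_upset_def\<close>)
  then show ?thesis by blast
qed

text \<open>Extending a morphism into \<open>N\<close> is the same as extending its clopen up-set, because \<open>\<phi>\<close> commutes with
  the action of words.\<close>

lemma mor_N_extension:
  assumes X: "double_ockham X" and Y: "double_ockham Y" and \<phi>: "\<phi> \<in> embedding X Y"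
    and \<alpha>: "\<alpha> \<in> mor X N_struct"
  shows "\<exists>\<beta>\<in>mor Y N_struct. \<forall>x\<in>univ X. \<beta> (\<phi> x) = \<alpha> x"
proof -
  note wf = double_ockham_imp_wf[OF X]
  obtain V where V: "clopen_upset Y V" "\<And>x. x \<in> univ X \<Longrightarrow> V (\<phi> x) \<longleftrightarrow> \<alpha> x []"
    using clopen_upset_extension[OF X Y \<phi> mor_N_upset[OF \<alpha>]] by blast
  have \<phi>m: "\<phi> x \<in> univ Y" "\<phi> (act X s x) = act Y s (\<phi> x)" if x: "x \<in> univ X" for x s
  proof -
    show "\<phi> x \<in> univ Y"
      using \<phi> x by (auto simp: embedding_def closed_subuniverse_def dest: closedin_subset)
    have act: "act (restrict_struct Y Z) s y = act Y s y" for Z y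
      by (induction Y s y rule: act.induct) (auto simp: restrict_struct_def)
    have "\<phi> \<in> mor X (restrict_struct Y (\<phi> ` univ X))"
      using \<phi> by (simp add: embedding_def struct_iso_def)
    from act_mor[OF this wf x] show "\<phi> (act X s x) = act Y s (\<phi> x)"
      by (simp add: act)
  qed
  have "orbit_map Y V (\<phi> x) = \<alpha> x" if x: "x \<in> univ X" for x
    using mor_N_eq[OF \<alpha> wf x] V(2)[OF act_in_univ[OF wf x]]
    by (simp add: orbit_map_def \<phi>m[OF x] fun_eq_iff flip: \<phi>m(2)[OF x])
  then show ?thesis using orbit_map_mor[OF Y V(1)] by blast
qed

lemma mor_NN_extension:
  assumes X: "double_ockham X" and Y: "double_ockham Y" and \<phi>: "\<phi> \<in> embedding X Y"
    and \<alpha>: "\<alpha> \<in> mor X NN_struct"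
  shows "\<exists>\<beta>\<in>mor Y NN_struct. \<forall>x\<in>univ X. \<beta> (\<phi> x) = \<alpha> x"
proof -
  note comp = mor_NN_components[OF double_ockham_imp_wf[OF X] \<alpha>]
  obtain \<beta> where \<beta>: "\<beta> \<in> mor Y N_struct" "\<forall>x\<in>univ X. \<beta> (\<phi> x) = fst (\<alpha> x)"
    using mor_N_extension[OF X Y \<phi> comp(1)] by auto
  obtain \<gamma> where \<gamma>: "\<gamma> \<in> mor Y N_struct" "\<forall>x\<in>univ X. \<gamma> (\<phi> x) = snd (\<alpha> x)"
    using mor_N_extension[OF X Y \<phi> comp(2)] by auto
  have "pair_map Y \<beta> \<gamma> \<in> mor Y NN_struct"
    using pair_map_mor[OF double_ockham_imp_wf[OF Y] \<beta>(1) \<gamma>(1)] .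
  moreover have "\<phi> x \<in> univ Y" if "x \<in> univ X" for x
    using \<phi> that by (auto simp: embedding_def closed_subuniverse_def dest: closedin_subset)
  ultimately show ?thesis
    using \<beta>(2) \<gamma>(2) by (intro bexI[of _ "pair_map Y \<beta> \<gamma>"]) (auto simp: pair_map_def)
qed


section \<open>Homomorphisms into \<open>M\<close> and bi-prime predicates\<close>

lemma carrier_M_alg [simp]: "carrier M_alg = UNIV"
  by (simp add: M_alg_def)

lemma M_alg_components [simp]:
  "fst (join_t M_alg a b) s \<longleftrightarrow> fst a s \<or> fst b s" "snd (join_t M_alg a b) s \<longleftrightarrow> snd a s \<and> snd b s"
  "fst (meet_t M_alg a b) s \<longleftrightarrow> fst a s \<and> fst b s" "snd (meet_t M_alg a b) s \<longleftrightarrow> snd a s \<or> snd b s"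
  "fst (join_k M_alg a b) s \<longleftrightarrow> fst a s \<or> fst b s" "snd (join_k M_alg a b) s \<longleftrightarrow> snd a s \<or> snd b s"
  "fst (meet_k M_alg a b) s \<longleftrightarrow> fst a s \<and> fst b s" "snd (meet_k M_alg a b) s \<longleftrightarrow> snd a s \<and> snd b s"
  "fst (neg M_alg a) = snd a" "snd (neg M_alg a) = fst a"
  "fst (conf M_alg a) s \<longleftrightarrow> \<not> snd a (s @ [e1])" "snd (conf M_alg a) s \<longleftrightarrow> \<not> fst a (s @ [e2])"
  "fst (zero M_alg) s \<longleftrightarrow> False" "snd (zero M_alg) s \<longleftrightarrow> True"
  "fst (one M_alg) s \<longleftrightarrow> True" "snd (one M_alg) s \<longleftrightarrow> False"
  by (simp_all add: M_alg_def N_f_def N_g_def split_beta)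

lemma M_eq_iff: "(a :: N \<times> N) = b \<longleftrightarrow> (\<forall>s. fst a s = fst b s) \<and> (\<forall>s. snd a s = snd b s)"
  by (auto simp: prod_eq_iff fun_eq_iff)

locale conflation_bilattice =
  fixes A :: "'a bilattice"
  assumes DB: "DB_minus A"
begin

abbreviation jt (infixl "\<squnion>\<^sub>t" 65) where "x \<squnion>\<^sub>t y \<equiv> join_t A x y"
abbreviation mt (infixl "\<sqinter>\<^sub>t" 70) where "x \<sqinter>\<^sub>t y \<equiv> meet_t A x y"
abbreviation jk (infixl "\<squnion>\<^sub>k" 65) where "x \<squnion>\<^sub>k y \<equiv> join_k A x y"
abbreviation mk (infixl "\<sqinter>\<^sub>k" 70) where "x \<sqinter>\<^sub>k y \<equiv> meet_k A x y"

lemma lattice_t: "bounded_lattice_on (carrier A) (join_t A) (meet_t A) (zero A) (one A)"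
  and lattice_k: "bounded_lattice_on (carrier A) (join_k A) (meet_k A) (bot_k A) (top_k A)"
  and neg_neg: "x \<in> carrier A \<Longrightarrow> neg A (neg A x) = x"
  and neg_k: "lattice_hom_on (carrier A) (join_k A) (meet_k A) (join_k A) (meet_k A) (neg A)"
  and neg_t: "lattice_hom_on (carrier A) (join_t A) (meet_t A) (meet_t A) (join_t A) (neg A)"
  and conf_t: "lattice_hom_on (carrier A) (join_t A) (meet_t A) (join_t A) (meet_t A) (conf A)"
  and conf_k: "lattice_hom_on (carrier A) (join_k A) (meet_k A) (meet_k A) (join_k A) (conf A)"
  and conf_zero: "conf A (zero A) = zero A"
  and conf_one: "conf A (one A) = one A"
  using DB unfolding DB_minus_def bounded_distributive_bilattice_def by blast+

lemma distributive:
  "f \<in> {join_t A, meet_t A, join_k A, meet_k A} \<Longrightarrow> g \<in> {join_t A, meet_t A, join_k A, meet_k A} \<Longrightarrow>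
     x \<in> carrier A \<Longrightarrow> y \<in> carrier A \<Longrightarrow> z \<in> carrier A \<Longrightarrow> f x (g y z) = g (f x y) (f x z)"
  using DB unfolding DB_minus_def bounded_distributive_bilattice_def distributes_over_on_def by blast

lemma closed [simp]:
  "zero A \<in> carrier A" "one A \<in> carrier A"
  "x \<in> carrier A \<Longrightarrow> y \<in> carrier A \<Longrightarrow> x \<squnion>\<^sub>t y \<in> carrier A"
  "x \<in> carrier A \<Longrightarrow> y \<in> carrier A \<Longrightarrow> x \<sqinter>\<^sub>t y \<in> carrier A"
  "x \<in> carrier A \<Longrightarrow> y \<in> carrier A \<Longrightarrow> x \<squnion>\<^sub>k y \<in> carrier A"
  "x \<in> carrier A \<Longrightarrow> y \<in> carrier A \<Longrightarrow> x \<sqinter>\<^sub>k y \<in> carrier A"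
  "x \<in> carrier A \<Longrightarrow> neg A x \<in> carrier A"
  "x \<in> carrier A \<Longrightarrow> conf A x \<in> carrier A"
  using lattice_t lattice_k neg_k conf_k unfolding bounded_lattice_on_def lattice_hom_on_def by blast+

lemma hom_laws:
  assumes "x \<in> carrier A" "y \<in> carrier A"
  shows "neg A (x \<squnion>\<^sub>t y) = neg A x \<sqinter>\<^sub>t neg A y" "neg A (x \<sqinter>\<^sub>t y) = neg A x \<squnion>\<^sub>t neg A y"
    "neg A (x \<squnion>\<^sub>k y) = neg A x \<squnion>\<^sub>k neg A y" "neg A (x \<sqinter>\<^sub>k y) = neg A x \<sqinter>\<^sub>k neg A y"
    "conf A (x \<squnion>\<^sub>t y) = conf A x \<squnion>\<^sub>t conf A y" "conf A (x \<sqinter>\<^sub>t y) = conf A x \<sqinter>\<^sub>t conf A y"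
    "conf A (x \<squnion>\<^sub>k y) = conf A x \<sqinter>\<^sub>k conf A y" "conf A (x \<sqinter>\<^sub>k y) = conf A x \<squnion>\<^sub>k conf A y"
  using neg_t neg_k conf_t conf_k assms unfolding lattice_hom_on_def by blast+

lemma commute:
  assumes "x \<in> carrier A" "y \<in> carrier A"
  shows "x \<squnion>\<^sub>t y = y \<squnion>\<^sub>t x" "x \<sqinter>\<^sub>t y = y \<sqinter>\<^sub>t x" "x \<squnion>\<^sub>k y = y \<squnion>\<^sub>k x" "x \<sqinter>\<^sub>k y = y \<sqinter>\<^sub>k x"
  using lattice_t lattice_k assms unfolding bounded_lattice_on_def by blast+

lemma absorb:
  assumes "x \<in> carrier A" "y \<in> carrier A"
  shows "x \<squnion>\<^sub>t x \<sqinter>\<^sub>t y = x" "x \<sqinter>\<^sub>t (x \<squnion>\<^sub>t y) = x" "x \<squnion>\<^sub>k x \<sqinter>\<^sub>k y = x" "x \<sqinter>\<^sub>k (x \<squnion>\<^sub>k y) = x"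
  using lattice_t lattice_k assms unfolding bounded_lattice_on_def by blast+

lemma units:
  assumes "x \<in> carrier A"
  shows "zero A \<squnion>\<^sub>t x = x" "one A \<sqinter>\<^sub>t x = x" "bot_k A \<squnion>\<^sub>k x = x" "top_k A \<sqinter>\<^sub>k x = x"
    "x \<squnion>\<^sub>t zero A = x" "x \<sqinter>\<^sub>t one A = x" "x \<sqinter>\<^sub>k top_k A = x"
proof -
  show *: "zero A \<squnion>\<^sub>t x = x" "one A \<sqinter>\<^sub>t x = x" "bot_k A \<squnion>\<^sub>k x = x" "top_k A \<sqinter>\<^sub>k x = x"
    using lattice_t lattice_k assms unfolding bounded_lattice_on_def by blast+
  show "x \<squnion>\<^sub>t zero A = x" "x \<sqinter>\<^sub>t one A = x" "x \<sqinter>\<^sub>k top_k A = x"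
    using * commute[OF assms] assms by simp_all
qed

lemma assoc_k:
  assumes "x \<in> carrier A" "y \<in> carrier A" "z \<in> carrier A"
  shows "x \<sqinter>\<^sub>k y \<sqinter>\<^sub>k z = x \<sqinter>\<^sub>k (y \<sqinter>\<^sub>k z)"
  using lattice_k assms unfolding bounded_lattice_on_def by blast

lemma idem:
  assumes "x \<in> carrier A"
  shows "x \<sqinter>\<^sub>t x = x" "x \<sqinter>\<^sub>k x = x" "x \<squnion>\<^sub>k x = x"
  using absorb[OF assms, of x] absorb[OF assms, of "x \<squnion>\<^sub>t x"] absorb[OF assms, of "x \<squnion>\<^sub>k x"]
    absorb[OF assms, of "x \<sqinter>\<^sub>k x"] assms by simp_all

lemma distribs:
  assumes "x \<in> carrier A" "y \<in> carrier A" "z \<in> carrier A"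
  shows "x \<sqinter>\<^sub>k (y \<squnion>\<^sub>k z) = x \<sqinter>\<^sub>k y \<squnion>\<^sub>k x \<sqinter>\<^sub>k z" "x \<sqinter>\<^sub>k (y \<squnion>\<^sub>t z) = x \<sqinter>\<^sub>k y \<squnion>\<^sub>t x \<sqinter>\<^sub>k z"
    "x \<sqinter>\<^sub>k (y \<sqinter>\<^sub>t z) = (x \<sqinter>\<^sub>k y) \<sqinter>\<^sub>t (x \<sqinter>\<^sub>k z)"
    "x \<squnion>\<^sub>t y \<sqinter>\<^sub>k z = (x \<squnion>\<^sub>t y) \<sqinter>\<^sub>k (x \<squnion>\<^sub>t z)" "x \<sqinter>\<^sub>t (y \<sqinter>\<^sub>k z) = x \<sqinter>\<^sub>t y \<sqinter>\<^sub>k (x \<sqinter>\<^sub>t z)"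
    "(y \<squnion>\<^sub>k z) \<sqinter>\<^sub>k x = y \<sqinter>\<^sub>k x \<squnion>\<^sub>k z \<sqinter>\<^sub>k x" "(y \<squnion>\<^sub>t z) \<sqinter>\<^sub>k x = y \<sqinter>\<^sub>k x \<squnion>\<^sub>t z \<sqinter>\<^sub>k x"
    "(y \<sqinter>\<^sub>t z) \<sqinter>\<^sub>k x = (y \<sqinter>\<^sub>k x) \<sqinter>\<^sub>t (z \<sqinter>\<^sub>k x)"
proof -
  show *: "x \<sqinter>\<^sub>k (y \<squnion>\<^sub>k z) = x \<sqinter>\<^sub>k y \<squnion>\<^sub>k x \<sqinter>\<^sub>k z" "x \<sqinter>\<^sub>k (y \<squnion>\<^sub>t z) = x \<sqinter>\<^sub>k y \<squnion>\<^sub>t x \<sqinter>\<^sub>k z"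
    "x \<sqinter>\<^sub>k (y \<sqinter>\<^sub>t z) = (x \<sqinter>\<^sub>k y) \<sqinter>\<^sub>t (x \<sqinter>\<^sub>k z)"
    "x \<squnion>\<^sub>t y \<sqinter>\<^sub>k z = (x \<squnion>\<^sub>t y) \<sqinter>\<^sub>k (x \<squnion>\<^sub>t z)" "x \<sqinter>\<^sub>t (y \<sqinter>\<^sub>k z) = x \<sqinter>\<^sub>t y \<sqinter>\<^sub>k (x \<sqinter>\<^sub>t z)"
    by (rule distributive; use assms in simp)+
  show "(y \<squnion>\<^sub>k z) \<sqinter>\<^sub>k x = y \<sqinter>\<^sub>k x \<squnion>\<^sub>k z \<sqinter>\<^sub>k x" "(y \<squnion>\<^sub>t z) \<sqinter>\<^sub>k x = y \<sqinter>\<^sub>k x \<squnion>\<^sub>t z \<sqinter>\<^sub>k x"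
    "(y \<sqinter>\<^sub>t z) \<sqinter>\<^sub>k x = (y \<sqinter>\<^sub>k x) \<sqinter>\<^sub>t (z \<sqinter>\<^sub>k x)"
    using * commute(4) assms closed by metis+
qed

lemma neg_bounds: "neg A (zero A) = one A" "neg A (one A) = zero A"
proof -
  have "neg A (zero A) \<sqinter>\<^sub>t one A = neg A (zero A \<squnion>\<^sub>t neg A (one A))"
    by (simp add: hom_laws neg_neg)
  also have "\<dots> = one A" by (simp add: units neg_neg)
  finally show "neg A (zero A) = one A" by (simp add: units)
  then show "neg A (one A) = zero A" using neg_neg closed by metis
qed

text \<open>In \<open>M\<close> the elements below \<open>1\<close> in the knowledge order are the pairs \<open>(a, 0)\<close>, on which the truth and
  knowledge operations are visibly the same. Abstractly, for \<open>x\<close> and \<open>y\<close> below \<open>1\<close>, distributivity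
  shows that the truth join and the knowledge join of \<open>x\<close> and \<open>y\<close> lie below each other in the
  knowledge order, and likewise for the meets.\<close>

lemma meet_one_t_eq_k:
  assumes "a \<in> carrier A" "b \<in> carrier A"
  shows "(a \<squnion>\<^sub>t b) \<sqinter>\<^sub>k one A = (a \<squnion>\<^sub>k b) \<sqinter>\<^sub>k one A" "(a \<sqinter>\<^sub>t b) \<sqinter>\<^sub>k one A = (a \<sqinter>\<^sub>k b) \<sqinter>\<^sub>k one A"
proof -
  define x where "x = a \<sqinter>\<^sub>k one A"
  define y where "y = b \<sqinter>\<^sub>k one A"
  have xy: "x \<in> carrier A" "y \<in> carrier A" using assms by (simp_all add: x_def y_def)
  have le1: "z \<sqinter>\<^sub>k one A \<sqinter>\<^sub>k one A = z \<sqinter>\<^sub>k one A" if "z \<in> carrier A" for z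
    using that by (simp add: assoc_k idem)
  \<comment> \<open>The knowledge bottom acts as a truth bottom for the elements below \<open>1\<close>.\<close>
  have bot: "z \<squnion>\<^sub>t bot_k A = z" "bot_k A \<sqinter>\<^sub>k z = bot_k A" if "z \<in> {x, y}" for z
  proof -
    have z: "z \<in> carrier A" and z1: "z \<sqinter>\<^sub>k one A = z"
      using that xy le1 assms by (auto simp: x_def y_def)
    have "z \<squnion>\<^sub>t one A = one A" using z absorb(1)[of "one A" z] by (simp add: units commute)
    then show "z \<squnion>\<^sub>t bot_k A = z" using z z1 by (simp add: distribs units)
    have "bot_k A \<sqinter>\<^sub>k (bot_k A \<squnion>\<^sub>k z) = bot_k A" using z by (intro absorb) simp_all
    then show "bot_k A \<sqinter>\<^sub>k z = bot_k A" using z by (simp add: units)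
  qed
  have le: "u \<sqinter>\<^sub>k (u \<squnion>\<^sub>t v) = u" if "u \<in> {x, y}" "v \<in> {x, y}" for u v
  proof -
    have uv: "u \<in> carrier A" "v \<in> carrier A" using that xy by auto
    have "u \<sqinter>\<^sub>k (u \<squnion>\<^sub>t v) = (u \<squnion>\<^sub>t bot_k A) \<sqinter>\<^sub>k (u \<squnion>\<^sub>t v)" using bot that by simp
    also have "\<dots> = u \<squnion>\<^sub>t (bot_k A \<sqinter>\<^sub>k v)" by (rule distribs(4)[symmetric]) (use uv in simp_all)
    also have "\<dots> = u" using bot that by simp
    finally show ?thesis .
  qed
  have "x \<sqinter>\<^sub>k (x \<squnion>\<^sub>t y) = x" "y \<sqinter>\<^sub>k (x \<squnion>\<^sub>t y) = y"
    using le[of x y] le[of y x] commute(1)[OF xy] by simp_all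
  then have "(x \<squnion>\<^sub>k y) \<sqinter>\<^sub>k (x \<squnion>\<^sub>t y) = x \<squnion>\<^sub>k y"
    using xy by (simp add: distribs(6))
  moreover have "(x \<squnion>\<^sub>t y) \<sqinter>\<^sub>k (x \<squnion>\<^sub>k y) = x \<squnion>\<^sub>t y"
    using xy absorb(4)[of x y] absorb(4)[of y x] commute(3)[OF xy] by (simp add: distribs(7))
  ultimately have "x \<squnion>\<^sub>t y = x \<squnion>\<^sub>k y"
    using commute(4)[of "x \<squnion>\<^sub>t y" "x \<squnion>\<^sub>k y"] xy by simp
  then show "(a \<squnion>\<^sub>t b) \<sqinter>\<^sub>k one A = (a \<squnion>\<^sub>k b) \<sqinter>\<^sub>k one A"
    using assms by (simp add: x_def y_def distribs(6,7))
  have below: "u \<sqinter>\<^sub>t v \<sqinter>\<^sub>k u = u \<sqinter>\<^sub>t v" if "u \<in> {x, y}" "v \<in> {x, y}" for u v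
  proof -
    have uv: "u \<in> carrier A" "v \<in> carrier A" "v \<sqinter>\<^sub>k one A = v"
      using that xy le1 assms by (auto simp: x_def y_def)
    have "u \<sqinter>\<^sub>t v \<sqinter>\<^sub>k u = u \<sqinter>\<^sub>t v \<sqinter>\<^sub>k (u \<sqinter>\<^sub>t one A)" using uv by (simp add: units)
    also have "\<dots> = u \<sqinter>\<^sub>t (v \<sqinter>\<^sub>k one A)" by (rule distribs(5)[symmetric]) (use uv in simp_all)
    finally show ?thesis using uv by simp
  qed
  have "x \<sqinter>\<^sub>t y \<sqinter>\<^sub>k (x \<sqinter>\<^sub>k y) = x \<sqinter>\<^sub>t y"
    using below[of x y] below[of y x] commute(2)[OF xy] xy by (simp flip: assoc_k)
  moreover have "x \<sqinter>\<^sub>k y \<sqinter>\<^sub>k (x \<sqinter>\<^sub>t y) = x \<sqinter>\<^sub>k y"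
  proof -
    have "x \<sqinter>\<^sub>k y \<sqinter>\<^sub>k x = x \<sqinter>\<^sub>k y"
      using xy assoc_k[of x x y] commute(4)[of "x \<sqinter>\<^sub>k y" x] by (simp add: idem)
    moreover have "x \<sqinter>\<^sub>k y \<sqinter>\<^sub>k y = x \<sqinter>\<^sub>k y"
      using xy by (simp add: assoc_k idem)
    ultimately show ?thesis using xy by (simp add: distribs(3) idem)
  qed
  ultimately have "x \<sqinter>\<^sub>t y = x \<sqinter>\<^sub>k y"
    using commute(4)[of "x \<sqinter>\<^sub>t y" "x \<sqinter>\<^sub>k y"] xy by simp
  moreover have "x \<sqinter>\<^sub>k y = (a \<sqinter>\<^sub>k b) \<sqinter>\<^sub>k one A"
    using assms commute(4)[of b "one A"] by (simp add: x_def y_def assoc_k idem flip: assoc_k[of "one A"])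
  ultimately show "(a \<sqinter>\<^sub>t b) \<sqinter>\<^sub>k one A = (a \<sqinter>\<^sub>k b) \<sqinter>\<^sub>k one A"
    using assms by (simp add: x_def y_def distribs(8))
qed

end

text \<open>Homomorphisms to the two-element lattice with respect to both pairs of lattice operations at once.
  Negation and conflation have no counterpart on the two-element lattice; they enter through
  \<open>spread\<close>.\<close>

definition bi_prime :: "'a bilattice \<Rightarrow> ('a \<Rightarrow> bool) \<Rightarrow> bool" where
  "bi_prime A \<pi> \<longleftrightarrow>
     (\<forall>x\<in>carrier A. \<forall>y\<in>carrier A.
        (\<pi> (join_t A x y) \<longleftrightarrow> \<pi> x \<or> \<pi> y) \<and> (\<pi> (join_k A x y) \<longleftrightarrow> \<pi> x \<or> \<pi> y) \<and>
        (\<pi> (meet_t A x y) \<longleftrightarrow> \<pi> x \<and> \<pi> y) \<and> (\<pi> (meet_k A x y) \<longleftrightarrow> \<pi> x \<and> \<pi> y)) \<and>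
     \<not> \<pi> (zero A) \<and> \<pi> (one A)"

text \<open>The composites of negation and conflation are dual endomorphisms of both lattices. They play the
  part of the two Ockham negations.\<close>

fun twist :: "'a bilattice \<Rightarrow> letter \<Rightarrow> 'a \<Rightarrow> 'a" where
  "twist A e1 x = conf A (neg A x)"
| "twist A e2 x = neg A (conf A x)"

text \<open>Each \<open>twist\<close> is order-reversing, so the value at a word of odd length has to be complemented.\<close>

definition spread :: "'a bilattice \<Rightarrow> ('a \<Rightarrow> bool) \<Rightarrow> 'a \<Rightarrow> N" where
  "spread A \<pi> x s \<longleftrightarrow> (\<pi> (foldr (twist A) s x) \<longleftrightarrow> even (length s))"

definition hom_of :: "'a bilattice \<Rightarrow> ('a \<Rightarrow> bool) \<Rightarrow> 'a \<Rightarrow> N \<times> N" where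
  "hom_of A \<pi> = (\<lambda>x\<in>carrier A. (spread A \<pi> x, spread A \<pi> (neg A x)))"

text \<open>The letter \<open>e\<close> acts on bi-prime predicates by \<open>\<pi> \<mapsto> \<not> \<pi> \<circ> twist A e\<close>; this drives
  the induction in \<open>bi_prime_spread\<close>.\<close>

lemma spread_Cons: "spread A \<pi> x (e # s) \<longleftrightarrow> spread A (\<lambda>y. \<not> \<pi> (twist A e y)) x s"
  by (auto simp: spread_def)

text \<open>The rule at the other end of the word is what makes conflation come out as in \<open>M\<close>, whose operations
  append a letter.\<close>

lemma spread_snoc: "spread A \<pi> x (s @ [e]) \<longleftrightarrow> \<not> spread A \<pi> (twist A e x) s"
  by (auto simp: spread_def)

lemma hom_bi_prime: "h \<in> alg_hom A M_alg \<Longrightarrow> bi_prime A (\<lambda>x. fst (h x) [])"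
  by (auto simp: alg_hom_def bi_prime_def)

context conflation_bilattice
begin

lemma twist_closed [simp]: "x \<in> carrier A \<Longrightarrow> twist A e x \<in> carrier A"
  by (cases e) simp_all

lemma twists_closed: "x \<in> carrier A \<Longrightarrow> foldr (twist A) s x \<in> carrier A"
  by (induction s) simp_all

lemma bi_prime_twist: "bi_prime A \<pi> \<Longrightarrow> bi_prime A (\<lambda>x. \<not> \<pi> (twist A e x))"
  by (cases e) (simp_all add: bi_prime_def hom_laws neg_bounds conf_zero conf_one)

lemma bi_prime_spread: "bi_prime A \<pi> \<Longrightarrow> bi_prime A (\<lambda>x. spread A \<pi> x s)"
proof (induction s arbitrary: \<pi>)
  case Nil
  then show ?case by (simp add: spread_def)
next
  case (Cons e s)
  then show ?case using bi_prime_twist[of \<pi> e] by (simp add: spread_Cons)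
qed

lemma hom_of_in_alg_hom:
  assumes "bi_prime A \<pi>"
  shows "hom_of A \<pi> \<in> alg_hom A M_alg"
proof -
  have s: "bi_prime A (\<lambda>x. spread A \<pi> x s)" for s using assms by (rule bi_prime_spread)
  have "spread A \<pi> (conf A x) s \<longleftrightarrow> \<not> spread A \<pi> (neg A x) (s @ [e1])"
    "spread A \<pi> (neg A (conf A x)) s \<longleftrightarrow> \<not> spread A \<pi> x (s @ [e2])" if "x \<in> carrier A" for x s
    using that by (simp_all add: spread_snoc neg_neg)
  then show ?thesis
    using s by (auto simp: alg_hom_def M_eq_iff hom_of_def bi_prime_def hom_laws neg_bounds neg_neg)
qed

text \<open>Induction on the word from its end: in \<open>M\<close> the first coordinate of \<open>twist\<close> applied to an element is
  the complement of the first coordinate of that element, read one letter further on.\<close>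

lemma hom_fst_spread:
  assumes "h \<in> alg_hom A M_alg" "x \<in> carrier A"
  shows "fst (h x) = spread A (\<lambda>x. fst (h x) []) x"
proof
  fix s
  show "fst (h x) s \<longleftrightarrow> spread A (\<lambda>x. fst (h x) []) x s"
    using assms(2)
  proof (induction s arbitrary: x rule: rev_induct)
    case Nil
    then show ?case by (simp add: spread_def)
  next
    case (snoc e s)
    have "fst (h (twist A e x)) s \<longleftrightarrow> \<not> fst (h x) (s @ [e])"
      using assms(1) snoc.prems by (cases e) (simp_all add: alg_hom_def)
    then show ?case using snoc by (simp add: spread_snoc)
  qed
qed

end


section \<open>Enough bi-prime predicates\<close>

text \<open>The prime filter theorem for distributive lattices: by Zorn's lemma there is a filter maximal among
  those that contain \<open>a\<close> but not \<open>b\<close>, and distributivity makes it prime. Here \<open>m a b \<noteq> a\<close> says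
  that \<open>a\<close> is not below \<open>b\<close>.\<close>

lemma prime_filter_exists:
  assumes L: "bounded_lattice_on L j m z u" and D: "distributes_over_on L m j"
    and ab: "a \<in> L" "b \<in> L" "m a b \<noteq> a"
  shows "\<exists>P. a \<in> P \<and> b \<notin> P \<and> (\<forall>x\<in>L. \<forall>y\<in>L. (m x y \<in> P \<longleftrightarrow> x \<in> P \<and> y \<in> P) \<and> (j x y \<in> P \<longleftrightarrow> x \<in> P \<or> y \<in> P))"
proof -
  have cl: "\<And>x y. x \<in> L \<Longrightarrow> y \<in> L \<Longrightarrow> j x y \<in> L" "\<And>x y. x \<in> L \<Longrightarrow> y \<in> L \<Longrightarrow> m x y \<in> L"
    and cm: "\<And>x y. x \<in> L \<Longrightarrow> y \<in> L \<Longrightarrow> m x y = m y x" "\<And>x y. x \<in> L \<Longrightarrow> y \<in> L \<Longrightarrow> j x y = j y x"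
    and ab': "\<And>x y. x \<in> L \<Longrightarrow> y \<in> L \<Longrightarrow> m x (j x y) = x" "\<And>x y. x \<in> L \<Longrightarrow> y \<in> L \<Longrightarrow> j x (m x y) = x"
    and as: "\<And>x y w. x \<in> L \<Longrightarrow> y \<in> L \<Longrightarrow> w \<in> L \<Longrightarrow> m (m x y) w = m x (m y w)"
    using L unfolding bounded_lattice_on_def by blast+
  have di: "\<And>x y w. x \<in> L \<Longrightarrow> y \<in> L \<Longrightarrow> w \<in> L \<Longrightarrow> m x (j y w) = j (m x y) (m x w)"
    using D unfolding distributes_over_on_def by blast
  have id: "m x x = x" if "x \<in> L" for x
    using ab'(1)[OF that cl(2)[OF that that]] ab'(2)[OF that that] by simp
  define filt where "filt = (\<lambda>F. F \<subseteq> L \<and> (\<forall>x\<in>F. \<forall>y\<in>F. m x y \<in> F) \<and> (\<forall>x\<in>F. \<forall>y\<in>L. m x y = x \<longrightarrow> y \<in> F))"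
  let ?\<A> = "{F. filt F \<and> a \<in> F \<and> b \<notin> F}"
  \<comment> \<open>The filter generated by \<open>F\<close> and \<open>x\<close>.\<close>
  have gen: "filt {y \<in> L. \<exists>f\<in>F. m (m f x) y = m f x}" "x \<in> L \<Longrightarrow> x \<in> {y \<in> L. \<exists>f\<in>F. m (m f x) y = m f x}"
    "F \<subseteq> {y \<in> L. \<exists>f\<in>F. m (m f x) y = m f x}"
    if F: "filt F" "F \<noteq> {}" and x: "x \<in> L" for F x
  proof -
    have FL: "f \<in> L" if "f \<in> F" for f using F that by (auto simp: filt_def)
    show "filt {y \<in> L. \<exists>f\<in>F. m (m f x) y = m f x}"
      unfolding filt_def
    proof (intro conjI ballI impI)
      fix y w assume "y \<in> {y \<in> L. \<exists>f\<in>F. m (m f x) y = m f x}" "w \<in> {y \<in> L. \<exists>f\<in>F. m (m f x) y = m f x}"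
      then obtain f g where fg: "f \<in> F" "g \<in> F" "m (m f x) y = m f x" "m (m g x) w = m g x" "y \<in> L" "w \<in> L"
        by blast
      have L': "f \<in> L" "g \<in> L" using FL fg by auto
      have e1: "m (m f g) x = m g (m f x)" "m (m f g) x = m f (m g x)"
        using L' x as cm by metis+
      have 1: "m (m (m f g) x) y = m (m f g) x" 
        unfolding e1(1) using as[of g "m f x" y] fg L' x cl by simp
      have 2: "m (m (m f g) x) w = m (m f g) x"
        unfolding e1(2) using as[of f "m g x" w] fg L' x cl by simp
      have "m (m (m f g) x) (m y w) = m (m f g) x"
        using as[of "m (m f g) x" y w] 1 2 fg L' x cl by simp
      moreover have "m f g \<in> F" using F fg by (auto simp: filt_def)
      ultimately show "m y w \<in> {y \<in> L. \<exists>f\<in>F. m (m f x) y = m f x}" using fg cl by blast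
    next
      fix y w assume "y \<in> {y \<in> L. \<exists>f\<in>F. m (m f x) y = m f x}" and w: "w \<in> L" "m y w = y"
      then obtain f where f: "f \<in> F" "m (m f x) y = m f x" "y \<in> L" by blast
      have "m (m f x) w = m f x"
        using as[of "m f x" y w] f w x FL cl by simp
      then show "w \<in> {y \<in> L. \<exists>f\<in>F. m (m f x) y = m f x}" using f w by blast
    qed blast
    show "x \<in> {y \<in> L. \<exists>f\<in>F. m (m f x) y = m f x}"
    proof -
      obtain f where "f \<in> F" using F by blast
      then have "m (m f x) x = m f x" using as[of f x x] id x FL by simp
      with x \<open>f \<in> F\<close> show ?thesis by blast
    qed
    show "F \<subseteq> {y \<in> L. \<exists>f\<in>F. m (m f x) y = m f x}"
    proof
      fix f assume f: "f \<in> F"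
      have "m (m f x) f = m f x" using as[of f f x] cm(1)[of "m f x" f] id f x FL cl by simp
      then show "f \<in> {y \<in> L. \<exists>f\<in>F. m (m f x) y = m f x}" using f FL by blast
    qed
  qed
  have "\<exists>M\<in>?\<A>. \<forall>X\<in>?\<A>. M \<subseteq> X \<longrightarrow> X = M"
  proof (rule subset_Zorn_nonempty)
    have "filt {y \<in> L. m a y = a}"
      unfolding filt_def
    proof (intro conjI ballI impI)
      fix x y assume "x \<in> {y \<in> L. m a y = a}" "y \<in> {y \<in> L. m a y = a}"
      then show "m x y \<in> {y \<in> L. m a y = a}" using as[of a x y] ab cl by simp
    next
      fix x y assume "x \<in> {y \<in> L. m a y = a}" "y \<in> L" "m x y = x"
      then show "y \<in> {y \<in> L. m a y = a}" using as[of a x y] ab by simp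
    qed blast
    then have "{y \<in> L. m a y = a} \<in> ?\<A>" using ab id by simp
    then show "?\<A> \<noteq> {}" by blast
  next
    fix \<C> assume ne: "\<C> \<noteq> {}" and ch: "subset.chain ?\<A> \<C>"
    have sub: "\<And>F. F \<in> \<C> \<Longrightarrow> filt F \<and> a \<in> F \<and> b \<notin> F" using ch by (auto simp: subset.chain_def)
    have "m x y \<in> \<Union>\<C>" if xy: "x \<in> \<Union>\<C>" "y \<in> \<Union>\<C>" for x y
    proof -
      obtain F G where "F \<in> \<C>" "x \<in> F" "G \<in> \<C>" "y \<in> G" using xy by blast
      moreover from this have "F \<subseteq> G \<or> G \<subseteq> F" using subset_chain_def ch by metis
      ultimately obtain H where "H \<in> \<C>" "x \<in> H" "y \<in> H" by blast
      then show ?thesis using sub unfolding filt_def by blast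
    qed
    moreover have "\<Union>\<C> \<subseteq> L" using sub unfolding filt_def by blast
    moreover have "y \<in> \<Union>\<C>" if "x \<in> \<Union>\<C>" "y \<in> L" "m x y = x" for x y
      using sub that unfolding filt_def by blast
    ultimately have "filt (\<Union>\<C>)" unfolding filt_def by blast
    then show "\<Union>\<C> \<in> ?\<A>" using sub ne by blast
  qed
  then obtain P where P: "filt P" "a \<in> P" "b \<notin> P" and max: "\<And>F. filt F \<Longrightarrow> b \<notin> F \<Longrightarrow> P \<subseteq> F \<Longrightarrow> F = P"
    by blast
  have PL: "\<And>x. x \<in> P \<Longrightarrow> x \<in> L" and up: "\<And>x y. x \<in> P \<Longrightarrow> y \<in> L \<Longrightarrow> m x y = x \<Longrightarrow> y \<in> P"
    and Pm: "\<And>x y. x \<in> P \<Longrightarrow> y \<in> P \<Longrightarrow> m x y \<in> P"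
    using P unfolding filt_def by blast+
  \<comment> \<open>By maximality, adding any further element to \<open>P\<close> brings in \<open>b\<close>.\<close>
  have outside: "\<exists>f\<in>P. m (m f x) b = m f x" if "x \<in> L" "x \<notin> P" for x
  proof (rule ccontr)
    assume "\<not> ?thesis"
    then have "{y \<in> L. \<exists>f\<in>P. m (m f x) y = m f x} = P"
      using gen[OF P(1) _ that(1)] P(2) by (intro max) blast+
    then show False using gen(2)[OF P(1) _ that(1)] P(2) that by blast
  qed
  have prime: "x \<in> P \<or> y \<in> P" if xy: "x \<in> L" "y \<in> L" "j x y \<in> P" for x y
  proof (rule ccontr)
    assume "\<not> ?thesis"
    then obtain f g where fg: "f \<in> P" "m (m f x) b = m f x" "g \<in> P" "m (m g y) b = m g y"
      using outside xy by blast
    define h where "h = m f g"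
    have L': "f \<in> L" "g \<in> L" "h \<in> L" "h \<in> P" using fg PL Pm cl by (auto simp: h_def)
    have e: "m h x = m g (m f x)" "m h y = m f (m g y)"
      unfolding h_def using L' xy as cm by metis+
    have "m (m h x) b = m h x" "m (m h y) b = m h y"
      unfolding e using as[of g "m f x" b] as[of f "m g y" b] fg L' xy cl ab by simp_all
    moreover have "m h (j x y) = j (m h x) (m h y)" using di L' xy by simp
    moreover have "m b (j (m h x) (m h y)) = j (m b (m h x)) (m b (m h y))"
      using di L' xy ab cl by simp
    ultimately have "m (m h (j x y)) b = m h (j x y)"
      using cm(1) L' xy ab cl by simp
    then show False using up[of "m h (j x y)" b] Pm[OF L'(4) xy(3)] ab P by blast
  qed
  have "m x y \<in> P \<longleftrightarrow> x \<in> P \<and> y \<in> P" if xy: "x \<in> L" "y \<in> L" for x y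
  proof
    assume mp: "m x y \<in> P"
    have "m (m x y) x = m x y" "m (m x y) y = m x y"
      using xy as[of x x y] as[of x y y] cm(1)[of "m x y" x] id cl by simp_all
    then show "x \<in> P \<and> y \<in> P" using up[OF mp] xy by blast
  qed (use Pm in blast)
  moreover have "j x y \<in> P \<longleftrightarrow> x \<in> P \<or> y \<in> P" if xy: "x \<in> L" "y \<in> L" for x y
  proof
    assume "x \<in> P \<or> y \<in> P"
    then show "j x y \<in> P"
      using xy ab'(1)[of x y] ab'(1)[of y x] cm(2)[of x y] up cl by metis
  qed (use prime xy in blast)
  ultimately show ?thesis
    using P(2,3) by (intro exI[of _ P]) simp
qed

context conflation_bilattice
begin

text \<open>A prime filter of the knowledge lattice that contains the part of \<open>a\<close> below \<open>1\<close> contains \<open>1\<close>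
  itself. Membership of \<open>x\<close> is then membership of the part of \<open>x\<close> below \<open>1\<close>, where the truth and
  knowledge operations agree.\<close>

lemma bi_prime_separates_meet_one:
  assumes ab: "a \<in> carrier A" "b \<in> carrier A"
    and ne: "a \<sqinter>\<^sub>k one A \<sqinter>\<^sub>k (b \<sqinter>\<^sub>k one A) \<noteq> a \<sqinter>\<^sub>k one A"
  shows "\<exists>\<pi>. bi_prime A \<pi> \<and> \<pi> a \<and> \<not> \<pi> b"
proof -
  have "distributes_over_on (carrier A) (meet_k A) (join_k A)"
    by (simp add: distributes_over_on_def distribs)
  from prime_filter_exists[OF lattice_k this, of "a \<sqinter>\<^sub>k one A" "b \<sqinter>\<^sub>k one A"] ab ne
  have "\<exists>P. a \<sqinter>\<^sub>k one A \<in> P \<and> b \<sqinter>\<^sub>k one A \<notin> P \<and>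
      (\<forall>x\<in>carrier A. \<forall>y\<in>carrier A. (x \<sqinter>\<^sub>k y \<in> P \<longleftrightarrow> x \<in> P \<and> y \<in> P) \<and> (x \<squnion>\<^sub>k y \<in> P \<longleftrightarrow> x \<in> P \<or> y \<in> P))"
    by simp
  then obtain P where
    P: "a \<sqinter>\<^sub>k one A \<in> P" "b \<sqinter>\<^sub>k one A \<notin> P"
      "\<And>x y. x \<in> carrier A \<Longrightarrow> y \<in> carrier A \<Longrightarrow> x \<sqinter>\<^sub>k y \<in> P \<longleftrightarrow> x \<in> P \<and> y \<in> P"
      "\<And>x y. x \<in> carrier A \<Longrightarrow> y \<in> carrier A \<Longrightarrow> x \<squnion>\<^sub>k y \<in> P \<longleftrightarrow> x \<in> P \<or> y \<in> P"
    by blast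
  have 1: "a \<in> P" "one A \<in> P" "b \<notin> P" using P ab by simp_all
  have t: "x \<squnion>\<^sub>t y \<in> P \<longleftrightarrow> x \<squnion>\<^sub>k y \<in> P" "x \<sqinter>\<^sub>t y \<in> P \<longleftrightarrow> x \<sqinter>\<^sub>k y \<in> P"
    if "x \<in> carrier A" "y \<in> carrier A" for x y
    using meet_one_t_eq_k[OF that] P(3)[of _ "one A"] 1(2) that closed by metis+
  have "zero A \<notin> P"
  proof
    assume "zero A \<in> P"
    then have "bot_k A \<in> P" using P(3) 1 by simp
    moreover have "bot_k A \<squnion>\<^sub>k b = b" using units ab by simp
    ultimately show False using P(4)[of "bot_k A" b] ab 1 by simp
  qed
  then have "bi_prime A (\<lambda>x. x \<in> P)"
    using P(3,4) 1 t by (simp add: bi_prime_def)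
  then show ?thesis using 1 by blast
qed

text \<open>An element is the knowledge join of its parts below \<open>1\<close> and below \<open>0\<close>, and negation exchanges the
  latter with the part of its negation below \<open>1\<close>.\<close>

lemma bi_prime_separates:
  assumes ab: "a \<in> carrier A" "b \<in> carrier A" and ne: "a \<noteq> b"
  shows "\<exists>\<pi>. bi_prime A \<pi> \<and> (\<pi> a \<noteq> \<pi> b \<or> \<pi> (neg A a) \<noteq> \<pi> (neg A b))"
proof (rule ccontr)
  assume no: "\<not> ?thesis"
  have eq: "x \<sqinter>\<^sub>k one A = y \<sqinter>\<^sub>k one A"
    if xy: "x \<in> carrier A" "y \<in> carrier A" "\<And>\<pi>. bi_prime A \<pi> \<Longrightarrow> \<pi> x = \<pi> y" for x y
    using bi_prime_separates_meet_one[OF xy(1,2)] bi_prime_separates_meet_one[OF xy(2,1)] xy(3)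
      commute(4)[of "x \<sqinter>\<^sub>k one A" "y \<sqinter>\<^sub>k one A"] xy(1,2) by (metis closed(2,6))
  have "a \<sqinter>\<^sub>k one A = b \<sqinter>\<^sub>k one A" "neg A a \<sqinter>\<^sub>k one A = neg A b \<sqinter>\<^sub>k one A"
    using no ab by (auto intro!: eq)
  moreover have "x = x \<sqinter>\<^sub>k one A \<squnion>\<^sub>k neg A (neg A x \<sqinter>\<^sub>k one A)" if x: "x \<in> carrier A" for x
  proof -
    have "x \<sqinter>\<^sub>k one A \<squnion>\<^sub>k neg A (neg A x \<sqinter>\<^sub>k one A) = x \<sqinter>\<^sub>k (zero A \<squnion>\<^sub>k one A)"
      using x commute(3)[of "x \<sqinter>\<^sub>k zero A" "x \<sqinter>\<^sub>k one A"]
      by (simp add: hom_laws neg_neg neg_bounds distribs)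
    then show ?thesis using x units by simp
  qed
  ultimately show False using ab ne by metis
qed

end


section \<open>Dual spaces\<close>

lemma alg_hom_eqs:
  assumes "h \<in> alg_hom A B"
  shows "x \<in> carrier A \<Longrightarrow> y \<in> carrier A \<Longrightarrow> h (join_t A x y) = join_t B (h x) (h y)"
    "x \<in> carrier A \<Longrightarrow> y \<in> carrier A \<Longrightarrow> h (meet_t A x y) = meet_t B (h x) (h y)"
    "x \<in> carrier A \<Longrightarrow> y \<in> carrier A \<Longrightarrow> h (join_k A x y) = join_k B (h x) (h y)"
    "x \<in> carrier A \<Longrightarrow> y \<in> carrier A \<Longrightarrow> h (meet_k A x y) = meet_k B (h x) (h y)"
    "x \<in> carrier A \<Longrightarrow> h (neg A x) = neg B (h x)" "x \<in> carrier A \<Longrightarrow> h (conf A x) = conf B (h x)"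
    "h (zero A) = zero B" "h (one A) = one B"
  using assms by (simp_all add: alg_hom_def)

text \<open>The operations of the algebra and of the structure are compatible, since conflation changes words
  at their end and the shifts at their beginning.\<close>

lemma operation_commutes:
  assumes "u = op1 NN_struct \<or> u = op2 NN_struct"
  shows "u (join_t M_alg a b) = join_t M_alg (u a) (u b)"
    "u (meet_t M_alg a b) = meet_t M_alg (u a) (u b)"
    "u (join_k M_alg a b) = join_k M_alg (u a) (u b)"
    "u (meet_k M_alg a b) = meet_k M_alg (u a) (u b)"
    "u (neg M_alg a) = neg M_alg (u a)" "u (conf M_alg a) = conf M_alg (u a)"
    "u (zero M_alg) = zero M_alg" "u (one M_alg) = one M_alg"
proof -
  have "fst (u c) s = fst c (e1 # s) \<and> snd (u c) s = snd c (e1 # s)" if "u = op1 NN_struct" for c s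
    using that by simp
  moreover have "fst (u c) s = fst c (e2 # s) \<and> snd (u c) s = snd c (e2 # s)" if "u = op2 NN_struct" for c s
    using that by simp
  ultimately obtain e where "fst (u c) s = fst c (e # s)" "snd (u c) s = snd c (e # s)" for c s
    using assms by metis
  then show "u (join_t M_alg a b) = join_t M_alg (u a) (u b)"
    "u (meet_t M_alg a b) = meet_t M_alg (u a) (u b)"
    "u (join_k M_alg a b) = join_k M_alg (u a) (u b)"
    "u (meet_k M_alg a b) = meet_k M_alg (u a) (u b)"
    "u (neg M_alg a) = neg M_alg (u a)" "u (conf M_alg a) = conf M_alg (u a)"
    "u (zero M_alg) = zero M_alg" "u (one M_alg) = one M_alg"
    by (simp_all add: M_eq_iff)
qed

lemma operation_mono:
  assumes "rel NN_struct a a'"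
  shows "rel NN_struct b b' \<Longrightarrow> rel NN_struct (join_t M_alg a b) (join_t M_alg a' b')"
    "rel NN_struct b b' \<Longrightarrow> rel NN_struct (meet_t M_alg a b) (meet_t M_alg a' b')"
    "rel NN_struct b b' \<Longrightarrow> rel NN_struct (join_k M_alg a b) (join_k M_alg a' b')"
    "rel NN_struct b b' \<Longrightarrow> rel NN_struct (meet_k M_alg a b) (meet_k M_alg a' b')"
    "rel NN_struct (neg M_alg a) (neg M_alg a')" "rel NN_struct (conf M_alg a) (conf M_alg a')"
proof -
  show "rel NN_struct b b' \<Longrightarrow> rel NN_struct (join_t M_alg a b) (join_t M_alg a' b')"
    "rel NN_struct b b' \<Longrightarrow> rel NN_struct (meet_t M_alg a b) (meet_t M_alg a' b')"
    "rel NN_struct b b' \<Longrightarrow> rel NN_struct (join_k M_alg a b) (join_k M_alg a' b')"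
    "rel NN_struct b b' \<Longrightarrow> rel NN_struct (meet_k M_alg a b) (meet_k M_alg a' b')"
    "rel NN_struct (neg M_alg a) (neg M_alg a')"
    using assms by simp_all
  have "(even (length (s @ [e])) \<longrightarrow> (fst a (s @ [e]) \<longrightarrow> fst a' (s @ [e])) \<and> (snd a (s @ [e]) \<longrightarrow> snd a' (s @ [e]))) \<and>
      (odd (length (s @ [e])) \<longrightarrow> (fst a' (s @ [e]) \<longrightarrow> fst a (s @ [e])) \<and> (snd a' (s @ [e]) \<longrightarrow> snd a (s @ [e])))" for s e
    using assms unfolding NN_struct_simps(1) N_struct_simps(1) by blast
  then show "rel NN_struct (conf M_alg a) (conf M_alg a')"
    unfolding NN_struct_simps(1) N_struct_simps(1) M_alg_components length_append_singleton even_Suc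
    by blast
qed

lemma closedin_Collect_Ball:
  assumes "\<And>i. i \<in> I \<Longrightarrow> closedin T {x \<in> topspace T. P i x}"
  shows "closedin T {x \<in> topspace T. \<forall>i\<in>I. P i x}"
proof -
  have "{x \<in> topspace T. \<forall>i\<in>I. P i x} = topspace T \<inter> (\<Inter>i\<in>I. {x \<in> topspace T. P i x})"
    by auto
  then show ?thesis
    using assms by (cases "I = {}") (auto intro!: closedin_Int closedin_INT)
qed

lemma closedin_Collect_conj:
  assumes "closedin T {x \<in> topspace T. P x}" "closedin T {x \<in> topspace T. Q x}"
  shows "closedin T {x \<in> topspace T. P x \<and> Q x}"
proof -
  have "{x \<in> topspace T. P x \<and> Q x} = {x \<in> topspace T. P x} \<inter> {x \<in> topspace T. Q x}"
    by auto
  then show ?thesis using assms by (simp add: closedin_Int)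
qed

lemma continuous_M_alg_operations:
  assumes "continuous_map T (tp NN_struct) F" "continuous_map T (tp NN_struct) G"
  shows "continuous_map T (tp NN_struct) (\<lambda>x. join_t M_alg (F x) (G x))"
    "continuous_map T (tp NN_struct) (\<lambda>x. meet_t M_alg (F x) (G x))"
    "continuous_map T (tp NN_struct) (\<lambda>x. join_k M_alg (F x) (G x))"
    "continuous_map T (tp NN_struct) (\<lambda>x. meet_k M_alg (F x) (G x))"
  using assms by (simp_all add: continuous_into_NN clopenp_conj clopenp_disj)

lemma continuous_M_alg_neg_conf:
  assumes "continuous_map T (tp NN_struct) F"
  shows "continuous_map T (tp NN_struct) (\<lambda>x. neg M_alg (F x))"
    "continuous_map T (tp NN_struct) (\<lambda>x. conf M_alg (F x))"
  using assms by (simp_all add: continuous_into_NN clopenp_not)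

lemma closedin_equalizer_NN:
  "continuous_map T (tp NN_struct) F \<Longrightarrow> continuous_map T (tp NN_struct) G \<Longrightarrow>
     closedin T {x \<in> topspace T. F x = G x}"
  using closedin_continuous_maps_eq[OF Hausdorff_NN] .

lemma continuous_coordinate:
  "i \<in> I \<Longrightarrow> continuous_map (tp (struct_power S I)) (tp S) (\<lambda>h. h i)"
  unfolding struct_power_def by (auto intro: continuous_map_product_projection)

lemma univ_struct_power_NN: "univ (struct_power NN_struct I) = I \<rightarrow>\<^sub>E UNIV"
  by (simp add: struct_power_def)

text \<open>Homomorphisms are the solutions of equations between continuous maps into a Hausdorff space.\<close>

lemma (in conflation_bilattice) closed_subuniverse_alg_hom:
  "closed_subuniverse (struct_power NN_struct (carrier A)) (alg_hom A M_alg)"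
proof -
  let ?P = "struct_power NN_struct (carrier A)"
  let ?C = "carrier A"
  have "closedin (tp ?P) {h \<in> univ ?P.
     (\<forall>x\<in>?C. \<forall>y\<in>?C.
        h (join_t A x y) = join_t M_alg (h x) (h y) \<and> h (meet_t A x y) = meet_t M_alg (h x) (h y) \<and>
        h (join_k A x y) = join_k M_alg (h x) (h y) \<and> h (meet_k A x y) = meet_k M_alg (h x) (h y)) \<and>
     (\<forall>x\<in>?C. h (neg A x) = neg M_alg (h x) \<and> h (conf A x) = conf M_alg (h x)) \<and>
     h (zero A) = zero M_alg \<and> h (one A) = one M_alg}"
    by (intro closedin_Collect_Ball closedin_Collect_conj closedin_equalizer_NN
        continuous_M_alg_operations continuous_M_alg_neg_conf continuous_coordinate closed)
      simp_all
  also have "\<dots> = alg_hom A M_alg"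
    by (simp only: alg_hom_def univ_struct_power_NN carrier_M_alg)
  finally have "closedin (tp ?P) (alg_hom A M_alg)" .
  moreover have "op1 ?P h \<in> alg_hom A M_alg" "op2 ?P h \<in> alg_hom A M_alg"
    if "h \<in> alg_hom A M_alg" for h
    using alg_hom_eqs[OF that] operation_commutes[of "op1 NN_struct"] operation_commutes[of "op2 NN_struct"]
    by (simp_all add: alg_hom_def struct_power_def)
  ultimately show ?thesis by (simp add: closed_subuniverse_def)
qed

lemma dual_space_simps [simp]:
  "rel (dual_space M S A) = (\<lambda>x y. \<forall>a\<in>carrier A. rel S (x a) (y a))"
  "op1 (dual_space M S A) = (\<lambda>x. \<lambda>a\<in>carrier A. op1 S (x a))"
  "op2 (dual_space M S A) = (\<lambda>x. \<lambda>a\<in>carrier A. op2 S (x a))"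
  by (simp_all add: dual_space_def restrict_struct_def struct_power_def)

lemma dual_algebra_simps [simp]:
  "carrier (dual_algebra M S X) = mor X S"
  "join_t (dual_algebra M S X) f g = (\<lambda>x\<in>univ X. join_t M (f x) (g x))"
  "meet_t (dual_algebra M S X) f g = (\<lambda>x\<in>univ X. meet_t M (f x) (g x))"
  "join_k (dual_algebra M S X) f g = (\<lambda>x\<in>univ X. join_k M (f x) (g x))"
  "meet_k (dual_algebra M S X) f g = (\<lambda>x\<in>univ X. meet_k M (f x) (g x))"
  "neg (dual_algebra M S X) f = (\<lambda>x\<in>univ X. neg M (f x))"
  "conf (dual_algebra M S X) f = (\<lambda>x\<in>univ X. conf M (f x))"
  "zero (dual_algebra M S X) = (\<lambda>x\<in>univ X. zero M)"
  "one (dual_algebra M S X) = (\<lambda>x\<in>univ X. one M)"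
  by (simp_all add: dual_algebra_def alg_power_def)

lemma struct_iso_refl: "wf_struct X \<Longrightarrow> (\<lambda>x\<in>univ X. x) \<in> struct_iso X X"
proof -
  assume wf: "wf_struct X"
  have "homeomorphic_map (tp X) (tp X) (\<lambda>x\<in>univ X. x)"
    by (rule homeomorphic_map_eq[of _ _ "\<lambda>x. x"]) (simp_all add: homeomorphic_map_id[unfolded id_def])
  then show ?thesis
    using wf homeomorphic_imp_continuous_map by (auto simp: struct_iso_def mor_def wf_struct_def)
qed

context conflation_bilattice
begin

abbreviation D :: "('a \<Rightarrow> N \<times> N) tstruct" where
  "D \<equiv> dual_space M_alg NN_struct A"

lemma univ_D [simp]: "univ D = alg_hom A M_alg"
  using univ_closed_substructure[OF closed_subuniverse_alg_hom] by (simp add: dual_space_def)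

lemma wf_D: "wf_struct D"
  using wf_closed_substructure[OF closed_subuniverse_alg_hom] by (simp add: dual_space_def)

lemma IScP_plus_D: "in_IScP_plus NN_struct D"
proof (rule in_IScP_plusI[OF _ closed_subuniverse_alg_hom])
  show "carrier A \<noteq> {}" using closed(1) by blast
  show "(\<lambda>x\<in>univ D. x) \<in> struct_iso D (restrict_struct (struct_power NN_struct (carrier A)) (alg_hom A M_alg))"
    using struct_iso_refl[OF wf_D] by (simp add: dual_space_def)
qed

lemma double_ockham_D: "double_ockham D"
  using IScP_plus_D IScP_plus_NN_iff by blast

lemma evaluation_mor:
  assumes "a \<in> carrier A"
  shows "(\<lambda>h\<in>alg_hom A M_alg. h a) \<in> mor D NN_struct"
proof -
  have "continuous_map (tp D) (tp NN_struct) (\<lambda>h. h a)"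
    unfolding dual_space_def restrict_struct_def struct_power_def
    using assms by (auto intro: continuous_map_from_subtopology continuous_map_product_projection)
  then have "continuous_map (tp D) (tp NN_struct) (\<lambda>h\<in>alg_hom A M_alg. h a)"
    by (rule continuous_map_eq) simp
  moreover have "op1 D h \<in> alg_hom A M_alg" "op2 D h \<in> alg_hom A M_alg" if "h \<in> alg_hom A M_alg" for h
    using wf_D that unfolding wf_struct_def univ_D by blast+
  ultimately show ?thesis
    using assms by (simp add: mor_def del: NN_struct_simps(1))
qed

lemma D_coordinate:
  assumes h: "h \<in> alg_hom A M_alg" and a: "a \<in> carrier A"
  shows "fst (h a) s \<longleftrightarrow> fst (act D s h a) []"
proof -
  have "act D s h \<in> alg_hom A M_alg"
    using act_in_univ[OF wf_D, of h s] h by simp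
  moreover have "fst ((\<lambda>h\<in>alg_hom A M_alg. h a) h) s \<longleftrightarrow>
      fst ((\<lambda>h\<in>alg_hom A M_alg. h a) (act D s h)) []"
    by (rule mor_NN_eq[OF evaluation_mor[OF a] wf_D]) (use h in simp)
  ultimately show ?thesis using h by (simp only: restrict_apply')
qed

text \<open>Domination at the empty word for all elements, applied to iterated twists of \<open>a\<close>, gives the
  comparison at all words, with the direction that the parity of the word prescribes.\<close>

lemma rel_D:
  assumes h: "h \<in> alg_hom A M_alg" and k: "k \<in> alg_hom A M_alg"
    and le: "\<And>a. a \<in> carrier A \<Longrightarrow> fst (h a) [] \<longrightarrow> fst (k a) []"
  shows "rel D h k"
proof -
  have "rel N_struct (fst (h a)) (fst (k a))" if "a \<in> carrier A" for a
    using le[OF twists_closed[OF that]] that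
    by (simp add: hom_fst_spread[OF h that] hom_fst_spread[OF k that]) (auto simp: spread_def)
  moreover have "snd (h a) = fst (h (neg A a))" "snd (k a) = fst (k (neg A a))" if "a \<in> carrier A" for a
    using h k that by (simp_all add: alg_hom_def)
  ultimately show ?thesis
    by (simp del: N_struct_simps)
qed

text \<open>The elements of \<open>A\<close> induce a lattice of clopen up-sets of the dual space, and by \<open>rel_D\<close> they
  separate any two points that are not comparable in the given direction. By compactness this
  lattice already consists of all clopen up-sets.\<close>

lemma D_upset_represented:
  assumes U: "clopen_upset D U"
  shows "\<exists>a\<in>carrier A. \<forall>h\<in>alg_hom A M_alg. U h \<longleftrightarrow> fst (h a) []"
proof -
  have Uc: "clopenp (tp D) U" using U by (simp add: clopen_upset_def)
  have "\<exists>a\<in>carrier A. (\<forall>h\<in>{h \<in> univ D. U h}. fst (h a) []) \<and> (\<forall>h\<in>{h \<in> univ D. \<not> U h}. \<not> fst (h a) [])"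
  proof (rule compact_separation)
    show "compact_space (tp D)" using double_ockham_D by (rule double_ockham_compact)
    show "closedin (tp D) {h \<in> univ D. U h}" "closedin (tp D) {h \<in> univ D. \<not> U h}"
      using Uc clopenp_not[OF Uc] by (simp_all only: clopenp_def)
  next
    fix a assume "a \<in> carrier A"
    from mor_NN_upset(1)[OF wf_D evaluation_mor[OF this]]
    have "clopenp (tp D) (\<lambda>h. fst ((\<lambda>h\<in>alg_hom A M_alg. h a) h) [])"
      by (simp only: clopen_upset_def)
    then show "clopenp (tp D) (\<lambda>h. fst (h a) [])"
      by (rule iffD1[OF clopenp_cong, rotated]) simp
  next
    show "\<exists>a\<in>carrier A. \<forall>h\<in>univ D. fst (h a) []"
      by (rule bexI[of _ "one A"]) (simp_all add: alg_hom_eqs)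
    show "\<exists>a\<in>carrier A. \<forall>h\<in>univ D. \<not> fst (h a) []"
      by (rule bexI[of _ "zero A"]) (simp_all add: alg_hom_eqs)
  next
    fix a b assume ab: "a \<in> carrier A" "b \<in> carrier A"
    then show "\<exists>c\<in>carrier A. \<forall>h\<in>univ D. fst (h c) [] \<longleftrightarrow> fst (h a) [] \<and> fst (h b) []"
      by (intro bexI[of _ "a \<sqinter>\<^sub>k b"]) (simp_all add: alg_hom_eqs)
    from ab show "\<exists>c\<in>carrier A. \<forall>h\<in>univ D. fst (h c) [] \<longleftrightarrow> fst (h a) [] \<or> fst (h b) []"
      by (intro bexI[of _ "a \<squnion>\<^sub>k b"]) (simp_all add: alg_hom_eqs)
  next
    fix h k assume "h \<in> {h \<in> univ D. U h}" "k \<in> {h \<in> univ D. \<not> U h}"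
    then have hk: "h \<in> alg_hom A M_alg" "k \<in> alg_hom A M_alg" "U h" "\<not> U k" by simp_all
    then have "\<not> rel D h k" using U unfolding clopen_upset_def univ_D by blast
    then show "\<exists>a\<in>carrier A. fst (h a) [] \<and> \<not> fst (k a) []"
      using rel_D[OF hk(1,2)] by blast
  qed
  then show ?thesis by auto
qed

lemma eval_alg_injective:
  assumes "a \<in> carrier A" "b \<in> carrier A" "eval_alg M_alg A a = eval_alg M_alg A b"
  shows "a = b"
proof (rule ccontr)
  assume "a \<noteq> b"
  then obtain \<pi> where \<pi>: "bi_prime A \<pi>" "\<pi> a \<noteq> \<pi> b \<or> \<pi> (neg A a) \<noteq> \<pi> (neg A b)"
    using bi_prime_separates assms by blast
  have "hom_of A \<pi> a = hom_of A \<pi> b"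
    using fun_cong[OF assms(3), of "hom_of A \<pi>"] assms(1,2) hom_of_in_alg_hom[OF \<pi>(1)]
    by (simp add: eval_alg_def)
  then have "spread A \<pi> a [] = spread A \<pi> b [] \<and> spread A \<pi> (neg A a) [] = spread A \<pi> (neg A b) []"
    using assms(1,2) by (simp add: hom_of_def)
  then show False using \<pi>(2) by (simp add: spread_def)
qed

text \<open>Take \<open>b\<close> and \<open>c\<close> for the two clopen up-sets of \<open>\<alpha>\<close>. In \<open>M\<close>, the meet with \<open>1\<close> keeps the first
  coordinate of \<open>b\<close>, and the meet with \<open>0\<close> keeps the second coordinate of the negation of \<open>c\<close>, which
  is the first coordinate of \<open>c\<close>. So the join \<open>a\<close> of these parts induces both up-sets.\<close>

lemma eval_alg_surjective:
  assumes \<alpha>: "\<alpha> \<in> mor D NN_struct"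
  shows "\<exists>a\<in>carrier A. eval_alg M_alg A a = \<alpha>"
proof -
  obtain b where b: "b \<in> carrier A" "\<And>h. h \<in> alg_hom A M_alg \<Longrightarrow> fst (\<alpha> h) [] \<longleftrightarrow> fst (h b) []"
    using D_upset_represented[OF mor_NN_upset(1)[OF wf_D \<alpha>]] by blast
  obtain c where c: "c \<in> carrier A" "\<And>h. h \<in> alg_hom A M_alg \<Longrightarrow> snd (\<alpha> h) [] \<longleftrightarrow> fst (h c) []"
    using D_upset_represented[OF mor_NN_upset(2)[OF wf_D \<alpha>]] by blast
  define a where "a = b \<sqinter>\<^sub>k one A \<squnion>\<^sub>k neg A c \<sqinter>\<^sub>k zero A"
  have a: "a \<in> carrier A" using b c by (simp add: a_def)
  have ha: "fst (h a) s \<longleftrightarrow> fst (h b) s" "snd (h a) s \<longleftrightarrow> fst (h c) s" if "h \<in> alg_hom A M_alg" for h s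
    using that b(1) c(1) by (simp_all add: alg_hom_eqs a_def)
  have "\<alpha> h = h a" if h: "h \<in> alg_hom A M_alg" for h
  proof -
    have act: "act D s h \<in> alg_hom A M_alg" for s
      using act_in_univ[OF wf_D, of h s] h by simp
    show ?thesis
      unfolding M_eq_iff ha[OF h]
      using mor_NN_eq[OF \<alpha> wf_D, of h] h b c act D_coordinate[OF h b(1)] D_coordinate[OF h c(1)]
      by simp
  qed
  then have "eval_alg M_alg A a = \<alpha>"
    using \<alpha> a by (auto simp: eval_alg_def mor_def extensional_def fun_eq_iff)
  with a show ?thesis by blast
qed

lemma eval_alg_iso: "eval_alg M_alg A \<in> alg_iso A (dual_algebra M_alg NN_struct D)"
proof -
  have eval: "eval_alg M_alg A a = (\<lambda>h\<in>alg_hom A M_alg. h a)" if "a \<in> carrier A" for a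
    using that by (simp add: eval_alg_def)
  have ext: "(\<lambda>h\<in>alg_hom A M_alg. F h) = (\<lambda>h\<in>alg_hom A M_alg. G h)"
    if "\<And>h. h \<in> alg_hom A M_alg \<Longrightarrow> F h = G h" for F G :: "('a \<Rightarrow> N \<times> N) \<Rightarrow> N \<times> N"
    using that by (rule restrict_ext)
  have "eval_alg M_alg A \<in> carrier A \<rightarrow>\<^sub>E mor D NN_struct"
    using evaluation_mor by (auto simp: eval_alg_def)
  then have "eval_alg M_alg A \<in> alg_hom A (dual_algebra M_alg NN_struct D)"
    unfolding alg_hom_def[of A "dual_algebra M_alg NN_struct D"]
    by (simp add: eval) (intro conjI ballI ext; simp add: alg_hom_def)
  moreover have "bij_betw (eval_alg M_alg A) (carrier A) (mor D NN_struct)"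
    unfolding bij_betw_def
  proof (intro conjI inj_onI set_eqI iffI)
    fix \<alpha> assume "\<alpha> \<in> eval_alg M_alg A ` carrier A"
    then show "\<alpha> \<in> mor D NN_struct" using evaluation_mor by (auto simp: eval_alg_def)
  qed (use eval_alg_injective eval_alg_surjective in blast)+
  ultimately show ?thesis by (simp add: alg_iso_def)
qed

end


section \<open>Dual algebras\<close>

lemma mor_NN_closed:
  assumes wf: "wf_struct X" and f: "f \<in> mor X NN_struct" and g: "g \<in> mor X NN_struct"
  shows "(\<lambda>x\<in>univ X. join_t M_alg (f x) (g x)) \<in> mor X NN_struct"
    "(\<lambda>x\<in>univ X. meet_t M_alg (f x) (g x)) \<in> mor X NN_struct"
    "(\<lambda>x\<in>univ X. join_k M_alg (f x) (g x)) \<in> mor X NN_struct"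
    "(\<lambda>x\<in>univ X. meet_k M_alg (f x) (g x)) \<in> mor X NN_struct"
    "(\<lambda>x\<in>univ X. neg M_alg (f x)) \<in> mor X NN_struct"
    "(\<lambda>x\<in>univ X. conf M_alg (f x)) \<in> mor X NN_struct"
proof -
  have restrict_mor: "(\<lambda>x\<in>univ X. F x) \<in> mor X NN_struct"
    if "continuous_map (tp X) (tp NN_struct) F"
      and "\<And>x y. x \<in> univ X \<Longrightarrow> y \<in> univ X \<Longrightarrow> rel X x y \<Longrightarrow> rel NN_struct (F x) (F y)"
      and "\<And>x. x \<in> univ X \<Longrightarrow> F (op1 X x) = op1 NN_struct (F x)"
      and "\<And>x. x \<in> univ X \<Longrightarrow> F (op2 X x) = op2 NN_struct (F x)" for F
  proof -
    have "continuous_map (tp X) (tp NN_struct) (\<lambda>x\<in>univ X. F x)"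
      using that(1) by (rule continuous_map_eq) simp
    then show ?thesis
      using that(2-4) wf by (simp add: mor_def wf_struct_def Pi_iff del: NN_struct_simps)
  qed
  have cont: "continuous_map (tp X) (tp NN_struct) k"
    and mono: "\<And>x y. x \<in> univ X \<Longrightarrow> y \<in> univ X \<Longrightarrow> rel X x y \<Longrightarrow> rel NN_struct (k x) (k y)"
    and eqs: "\<And>x. x \<in> univ X \<Longrightarrow> k (op1 X x) = op1 NN_struct (k x)"
      "\<And>x. x \<in> univ X \<Longrightarrow> k (op2 X x) = op2 NN_struct (k x)"
    if "k \<in> mor X NN_struct" for k
    using that unfolding mor_def by blast+
  note rules = continuous_M_alg_operations continuous_M_alg_neg_conf cont[OF f] cont[OF g]
    operation_mono mono[OF f] mono[OF g]
  note commutes = eqs[OF f] eqs[OF g] operation_commutes[of "op1 NN_struct"] operation_commutes[of "op2 NN_struct"]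
  show "(\<lambda>x\<in>univ X. join_t M_alg (f x) (g x)) \<in> mor X NN_struct"
    "(\<lambda>x\<in>univ X. meet_t M_alg (f x) (g x)) \<in> mor X NN_struct"
    "(\<lambda>x\<in>univ X. join_k M_alg (f x) (g x)) \<in> mor X NN_struct"
    "(\<lambda>x\<in>univ X. meet_k M_alg (f x) (g x)) \<in> mor X NN_struct"
    "(\<lambda>x\<in>univ X. neg M_alg (f x)) \<in> mor X NN_struct"
    "(\<lambda>x\<in>univ X. conf M_alg (f x)) \<in> mor X NN_struct"
    by (rule restrict_mor; (intro rules; assumption | simp only: commutes simp_thms))+
qed

lemma mor_NN_constants:
  assumes wf: "wf_struct X"
  shows "(\<lambda>x\<in>univ X. zero M_alg) \<in> mor X NN_struct" "(\<lambda>x\<in>univ X. one M_alg) \<in> mor X NN_struct"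
    "(\<lambda>x\<in>univ X. bot_k M_alg) \<in> mor X NN_struct" "(\<lambda>x\<in>univ X. top_k M_alg) \<in> mor X NN_struct"
proof -
  have const_mor: "(\<lambda>x\<in>univ X. c) \<in> mor X NN_struct" if "op1 NN_struct c = c" "op2 NN_struct c = c" for c
  proof -
    have "continuous_map (tp X) (tp NN_struct) (\<lambda>x. c)" by simp
    then have "continuous_map (tp X) (tp NN_struct) (\<lambda>x\<in>univ X. c)"
      by (rule continuous_map_eq) simp
    then show ?thesis
      using that wf by (simp add: mor_def wf_struct_def Pi_iff del: NN_struct_simps(2-))
  qed
  show "(\<lambda>x\<in>univ X. zero M_alg) \<in> mor X NN_struct" "(\<lambda>x\<in>univ X. one M_alg) \<in> mor X NN_struct"
    "(\<lambda>x\<in>univ X. bot_k M_alg) \<in> mor X NN_struct" "(\<lambda>x\<in>univ X. top_k M_alg) \<in> mor X NN_struct"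
    by (rule const_mor; simp add: operation_commutes)+
qed

text \<open>All identities are checked pointwise, where they become propositional tautologies about the
  coordinates.\<close>

lemma DB_minus_dual_algebra:
  assumes wf: "wf_struct X"
  shows "DB_minus (dual_algebra M_alg NN_struct X)"
proof -
  have eq: "(\<lambda>x\<in>univ X. F x) = g \<longleftrightarrow> (\<forall>x\<in>univ X. F x = g x)" if "g \<in> extensional (univ X)" for F and g :: "_ \<Rightarrow> N \<times> N"
    using that by (auto simp: fun_eq_iff extensional_def)
  have ext: "g \<in> extensional (univ X)" if "g \<in> mor X NN_struct" for g :: "_ \<Rightarrow> N \<times> N"
    using that by (simp add: mor_def)
  let ?E = "dual_algebra M_alg NN_struct X"
  note simps = eq ext mor_NN_closed[OF wf] mor_NN_constants[OF wf] M_eq_iff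
  have lattice: "bounded_lattice_on (carrier ?E) (join_t ?E) (meet_t ?E) (zero ?E) (one ?E)"
    "bounded_lattice_on (carrier ?E) (join_k ?E) (meet_k ?E) (bot_k ?E) (top_k ?E)"
    unfolding bounded_lattice_on_def dual_algebra_simps by (auto simp: simps cong: restrict_cong)
  have distributive: "\<forall>f\<in>{join_t ?E, meet_t ?E, join_k ?E, meet_k ?E}.
      \<forall>g\<in>{join_t ?E, meet_t ?E, join_k ?E, meet_k ?E}. distributes_over_on (carrier ?E) f g"
    unfolding distributes_over_on_def dual_algebra_simps ball_simps
    by (intro conjI ballI TrueI) (auto simp: simps cong: restrict_cong)
  have neg: "\<forall>f\<in>carrier ?E. neg ?E (neg ?E f) = f"
    "lattice_hom_on (carrier ?E) (join_k ?E) (meet_k ?E) (join_k ?E) (meet_k ?E) (neg ?E)"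
    "lattice_hom_on (carrier ?E) (join_t ?E) (meet_t ?E) (meet_t ?E) (join_t ?E) (neg ?E)"
    unfolding lattice_hom_on_def dual_algebra_simps by (auto simp: simps cong: restrict_cong)
  have conf: "lattice_hom_on (carrier ?E) (join_t ?E) (meet_t ?E) (join_t ?E) (meet_t ?E) (conf ?E)"
    "lattice_hom_on (carrier ?E) (join_k ?E) (meet_k ?E) (meet_k ?E) (join_k ?E) (conf ?E)"
    unfolding lattice_hom_on_def dual_algebra_simps by (auto simp: simps cong: restrict_cong)
  have "conf ?E (zero ?E) = zero ?E" "conf ?E (one ?E) = one ?E"
    "conf ?E (bot_k ?E) = top_k ?E" "conf ?E (top_k ?E) = bot_k ?E"
    by (auto simp: simps cong: restrict_cong)
  with lattice distributive neg conf show ?thesis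
    unfolding DB_minus_def bounded_distributive_bilattice_def by blast
qed


section \<open>Fullness\<close>

lemma conflation_bilattice_dual_algebra:
  "wf_struct X \<Longrightarrow> conflation_bilattice (dual_algebra M_alg NN_struct X)"
  by (simp add: conflation_bilattice_def DB_minus_dual_algebra)

text \<open>If \<open>\<alpha>\<close> is dominated by \<open>\<beta>\<close> in the first coordinate at the empty word, it is so at all words, so the
  part of \<open>\<alpha>\<close> below \<open>1\<close> lies below \<open>\<beta>\<close> in the knowledge order.\<close>

lemma bi_prime_mono:
  assumes wf: "wf_struct X" and \<alpha>: "\<alpha> \<in> mor X NN_struct" and \<beta>: "\<beta> \<in> mor X NN_struct"
    and le: "\<And>x. x \<in> univ X \<Longrightarrow> fst (\<alpha> x) [] \<longrightarrow> fst (\<beta> x) []"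
    and \<pi>: "bi_prime (dual_algebra M_alg NN_struct X) \<pi>" "\<pi> \<alpha>"
  shows "\<pi> \<beta>"
proof -
  let ?E = "dual_algebra M_alg NN_struct X"
  interpret E: conflation_bilattice ?E using conflation_bilattice_dual_algebra[OF wf] .
  have le': "fst (\<alpha> x) s \<longrightarrow> fst (\<beta> x) s" if "x \<in> univ X" for x s
    using mor_NN_eq(1)[OF \<alpha> wf that, of s] mor_NN_eq(1)[OF \<beta> wf that, of s] le[OF act_in_univ[OF wf that]]
    by simp
  have "meet_k ?E (meet_k ?E \<alpha> (one ?E)) \<beta> = meet_k ?E \<alpha> (one ?E)"
    using le' by (auto simp: M_eq_iff intro!: restrict_ext)
  moreover have "\<pi> (meet_k ?E \<alpha> (one ?E))"
    using \<pi> \<alpha> E.closed(2) by (simp add: bi_prime_def del: dual_algebra_simps(2-))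
  moreover have "meet_k ?E \<alpha> (one ?E) \<in> carrier ?E"
    using \<alpha> by (intro E.closed) simp_all
  ultimately show ?thesis
    using \<pi>(1) \<beta> unfolding bi_prime_def by (metis dual_algebra_simps(1))
qed

text \<open>Suppose that each point \<open>x\<close> has a morphism whose value at \<open>x\<close> disagrees with \<open>\<pi>\<close>. If that morphism
  satisfies \<open>\<pi>\<close>, it is compared with \<open>0\<close>, otherwise \<open>1\<close> is compared with it: near \<open>x\<close> there are thus
  \<open>\<alpha>\<close> satisfying \<open>\<pi>\<close> and \<open>\<beta>\<close> not satisfying it with \<open>\<alpha>\<close> dominated by \<open>\<beta>\<close>. Meets of the former and joins
  of the latter extend this to all of \<open>X\<close> by compactness, against the monotonicity of \<open>\<pi>\<close>.\<close>

lemma bi_prime_dual_algebra_is_point: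
  assumes X: "double_ockham X" and \<pi>: "bi_prime (dual_algebra M_alg NN_struct X) \<pi>"
  shows "\<exists>x\<in>univ X. \<forall>\<alpha>\<in>mor X NN_struct. \<pi> \<alpha> \<longleftrightarrow> fst (\<alpha> x) []"
proof (rule ccontr)
  assume no: "\<not> ?thesis"
  let ?E = "dual_algebra M_alg NN_struct X"
  note wf = double_ockham_imp_wf[OF X]
  interpret E: conflation_bilattice ?E using conflation_bilattice_dual_algebra[OF wf] .
  have carrier: "carrier ?E = mor X NN_struct" by simp
  have bounds: "zero ?E \<in> mor X NN_struct" "one ?E \<in> mor X NN_struct"
    using E.closed(1,2) unfolding carrier by blast+
  have \<pi>_bounds: "\<not> \<pi> (zero ?E)" "\<pi> (one ?E)"
    using \<pi> by (simp_all add: bi_prime_def del: dual_algebra_simps(2-))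
  have bounds_fst: "fst (zero ?E x) [] \<longleftrightarrow> False" "fst (one ?E x) [] \<longleftrightarrow> True" if "x \<in> univ X" for x
    using that by simp_all
  define \<Phi> where "\<Phi> = (\<lambda>W. \<exists>\<alpha>\<in>mor X NN_struct. \<exists>\<beta>\<in>mor X NN_struct. \<pi> \<alpha> \<and> \<not> \<pi> \<beta> \<and>
    (\<forall>x\<in>W \<inter> univ X. fst (\<alpha> x) [] \<longrightarrow> fst (\<beta> x) []))"
  have "\<Phi> (univ X)"
  proof (rule compactin_local_to_global)
    show "compactin (tp X) (univ X)"
      using double_ockham_compact[OF X] by (simp add: compact_space_def)
    show "\<Phi> {}"
      unfolding \<Phi>_def using bounds \<pi>_bounds by blast
  next
    fix A B assume "\<Phi> A" "\<Phi> B"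
    then obtain \<alpha> \<beta> \<gamma> \<delta> where
      \<alpha>: "\<alpha> \<in> mor X NN_struct" "\<beta> \<in> mor X NN_struct" "\<pi> \<alpha>" "\<not> \<pi> \<beta>"
        "\<forall>x\<in>A \<inter> univ X. fst (\<alpha> x) [] \<longrightarrow> fst (\<beta> x) []" and
      \<gamma>: "\<gamma> \<in> mor X NN_struct" "\<delta> \<in> mor X NN_struct" "\<pi> \<gamma>" "\<not> \<pi> \<delta>"
        "\<forall>x\<in>B \<inter> univ X. fst (\<gamma> x) [] \<longrightarrow> fst (\<delta> x) []"
      unfolding \<Phi>_def by blast
    have "meet_k ?E \<alpha> \<gamma> \<in> mor X NN_struct" "join_k ?E \<beta> \<delta> \<in> mor X NN_struct"
      using E.closed(5,6) \<alpha>(1,2) \<gamma>(1,2) unfolding carrier by blast+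
    moreover have "\<pi> (meet_k ?E \<alpha> \<gamma>)" "\<not> \<pi> (join_k ?E \<beta> \<delta>)"
      using \<pi> \<alpha> \<gamma> unfolding bi_prime_def carrier by blast+
    moreover have "fst (meet_k ?E \<alpha> \<gamma> x) [] \<longrightarrow> fst (join_k ?E \<beta> \<delta> x) []" if "x \<in> (A \<union> B) \<inter> univ X" for x
      using that \<alpha>(5) \<gamma>(5) by auto
    ultimately show "\<Phi> (A \<union> B)" unfolding \<Phi>_def by blast
  next
    fix A B assume "A \<subseteq> B" "\<Phi> B"
    then show "\<Phi> A" unfolding \<Phi>_def by blast
  next
    fix x assume x: "x \<in> univ X"
    then obtain \<alpha> where \<alpha>: "\<alpha> \<in> mor X NN_struct" "\<pi> \<alpha> \<longleftrightarrow> \<not> fst (\<alpha> x) []"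
      using no by blast
    have clop: "clopenp (tp X) (\<lambda>x. fst (\<alpha> x) [])"
      using mor_NN_upset(1)[OF wf \<alpha>(1)] by (simp add: clopen_upset_def)
    show "\<exists>W. openin (tp X) W \<and> x \<in> W \<and> \<Phi> W"
    proof (cases "\<pi> \<alpha>")
      case True
      have "\<Phi> {x \<in> univ X. \<not> fst (\<alpha> x) []}"
        unfolding \<Phi>_def using \<alpha>(1) bounds \<pi>_bounds bounds_fst True by blast
      then show ?thesis
        using x \<alpha>(2) True clopenp_not[OF clop] unfolding clopenp_def by blast
    next
      case False
      have "\<Phi> {x \<in> univ X. fst (\<alpha> x) []}"
        unfolding \<Phi>_def using \<alpha>(1) bounds \<pi>_bounds bounds_fst False by blast
      then show ?thesis
        using x \<alpha>(2) False clop unfolding clopenp_def by blast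
    qed
  qed
  then obtain \<alpha> \<beta> where "\<alpha> \<in> mor X NN_struct" "\<beta> \<in> mor X NN_struct" "\<pi> \<alpha>" "\<not> \<pi> \<beta>"
    "\<And>x. x \<in> univ X \<Longrightarrow> fst (\<alpha> x) [] \<longrightarrow> fst (\<beta> x) []"
    unfolding \<Phi>_def by blast
  then show False using bi_prime_mono[OF wf _ _ _ \<pi>] by blast
qed

text \<open>Evaluation is a continuous map from a compact to a Hausdorff space, so bijectivity suffices for a
  homeomorphism. Every homomorphism has the same bi-prime predicate as some evaluation, and the two
  then lie below each other by \<open>rel_D\<close>.\<close>

lemma eval_struct_iso:
  assumes X: "double_ockham X"
  shows "eval_struct NN_struct X \<in>
    struct_iso X (dual_space M_alg NN_struct (dual_algebra M_alg NN_struct X))"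
proof -
  let ?E = "dual_algebra M_alg NN_struct X" and ?H = "mor X NN_struct"
  note wf = double_ockham_imp_wf[OF X]
  interpret E: conflation_bilattice ?E using conflation_bilattice_dual_algebra[OF wf] .
  let ?D = "dual_space M_alg NN_struct ?E" and ?\<epsilon> = "eval_struct NN_struct X"
  have \<epsilon>: "?\<epsilon> x = (\<lambda>\<alpha>\<in>?H. \<alpha> x)" if "x \<in> univ X" for x
    using that by (simp add: eval_struct_def)
  have op: "op1 X x \<in> univ X" "op2 X x \<in> univ X" if "x \<in> univ X" for x
    using wf that by (auto simp: wf_struct_def)
  have mor: "\<alpha> (op1 X x) = op1 NN_struct (\<alpha> x)" "\<alpha> (op2 X x) = op2 NN_struct (\<alpha> x)"
    "y \<in> univ X \<Longrightarrow> rel X x y \<Longrightarrow> rel NN_struct (\<alpha> x) (\<alpha> y)"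
    "continuous_map (tp X) (tp NN_struct) \<alpha>"
    if "\<alpha> \<in> ?H" "x \<in> univ X" for \<alpha> x y
    using that unfolding mor_def by blast+
  have \<epsilon>_hom: "?\<epsilon> x \<in> alg_hom ?E M_alg" if x: "x \<in> univ X" for x
    using E.closed x unfolding alg_hom_def by (simp add: \<epsilon>)
  have surj: "\<exists>x\<in>univ X. ?\<epsilon> x = h" if h: "h \<in> alg_hom ?E M_alg" for h
  proof -
    obtain x where x: "x \<in> univ X" "\<forall>\<alpha>\<in>?H. fst (h \<alpha>) [] \<longleftrightarrow> fst (\<alpha> x) []"
      using bi_prime_dual_algebra_is_point[OF X hom_bi_prime[OF h]] by blast
    have "rel ?D (?\<epsilon> x) h" "rel ?D h (?\<epsilon> x)"
      using x h \<epsilon>_hom[OF x(1)] by (auto intro!: E.rel_D simp: \<epsilon> simp del: dual_space_simps)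
    then show ?thesis
      using x h \<epsilon>_hom[OF x(1)] double_ockham_antisym[OF E.double_ockham_D] E.univ_D by blast
  qed
  have rel: "rel ?D (?\<epsilon> x) (?\<epsilon> y) \<longleftrightarrow> rel X x y" if xy: "x \<in> univ X" "y \<in> univ X" for x y
  proof
    assume "rel ?D (?\<epsilon> x) (?\<epsilon> y)"
    then have "fst (\<alpha> x) [] \<longrightarrow> fst (\<alpha> y) []" if "\<alpha> \<in> ?H" for \<alpha>
      using that xy by (force simp: \<epsilon> dest!: bspec[OF _ that] spec[of _ "[]"])
    then show "rel X x y" by (rule mor_NN_reflects_order[OF X xy])
  next
    assume "rel X x y"
    then show "rel ?D (?\<epsilon> x) (?\<epsilon> y)"
      using mor(3) xy by (simp add: \<epsilon> del: NN_struct_simps(1))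
  qed
  have inj: "inj_on ?\<epsilon> (univ X)"
  proof
    fix x y assume xy: "x \<in> univ X" "y \<in> univ X" "?\<epsilon> x = ?\<epsilon> y"
    have "rel X x y" "rel X y x"
      using rel[OF xy(1,2)] rel[OF xy(2,1)] rel[OF xy(1,1)] rel[OF xy(2,2)] xy(3) double_ockham_refl[OF X] xy(1,2)
      by metis+
    then show "x = y" using double_ockham_antisym[OF X] xy by blast
  qed
  have "continuous_map (tp X) (tp (struct_power NN_struct (carrier ?E))) (\<lambda>x. \<lambda>\<alpha>\<in>?H. \<alpha> x)"
    unfolding struct_power_def by (auto simp: continuous_map_componentwise mor_def)
  then have "continuous_map (tp X) (tp (struct_power NN_struct (carrier ?E))) ?\<epsilon>"
    by (rule continuous_map_eq) (simp add: \<epsilon>)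
  then have cont: "continuous_map (tp X) (tp ?D) ?\<epsilon>"
    using \<epsilon>_hom by (auto simp: dual_space_def restrict_struct_def continuous_map_in_subtopology)
  have "homeomorphic_map (tp X) (tp ?D) ?\<epsilon>"
  proof (rule continuous_imp_homeomorphic_map[OF cont double_ockham_compact[OF X] _ _ inj])
    show "Hausdorff_space (tp ?D)"
      using Hausdorff_NN unfolding dual_space_def restrict_struct_def struct_power_def
      by (simp add: Hausdorff_space_subtopology Hausdorff_space_product_topology)
    show "?\<epsilon> ` univ X = univ ?D"
      unfolding E.univ_D using surj \<epsilon>_hom by blast
  qed
  moreover have "?\<epsilon> \<in> mor X ?D"
    unfolding mor_def[of X ?D]
  proof (intro CollectI conjI ballI impI cont)
    show "?\<epsilon> \<in> extensional (univ X)" by (simp add: eval_struct_def)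
  next
    fix x assume x: "x \<in> univ X"
    show "?\<epsilon> (op1 X x) = op1 ?D (?\<epsilon> x)" "?\<epsilon> (op2 X x) = op2 ?D (?\<epsilon> x)"
      using x op[OF x] mor(1,2) by (auto simp: \<epsilon> intro!: restrict_ext)
  qed (simp only: rel)
  ultimately show ?thesis
    unfolding struct_iso_def using wf E.wf_D rel by blast
qed


section \<open>The duality\<close>

theorem theorem5p7:
  shows "yields_strong_duality TYPE('a) TYPE('x) TYPE('y) M_alg (struct_prod N_struct N_struct) \<and>
    (\<forall>X :: 'x tstruct.
       in_IScP_plus (struct_prod N_struct N_struct) X \<longleftrightarrow> in_IScP_plus N_struct X) \<and>
    (\<forall>X :: 'x tstruct.
       in_IScP_plus N_struct X \<longleftrightarrow> double_ockham_space (tp X) (rel X) (op1 X) (op2 X)) \<and>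
    (\<forall>(X :: 'x tstruct) (Y :: 'y tstruct).
       in_IScP_plus N_struct X \<and> in_IScP_plus N_struct Y \<longrightarrow>
       mor X Y =
         double_ockham_mor (tp X) (rel X) (op1 X) (op2 X) (tp Y) (rel Y) (op1 Y) (op2 Y))"
proof (intro conjI allI impI)
  have "yields_duality TYPE('a) TYPE('x) M_alg NN_struct"
    unfolding yields_duality_def IScP_plus_NN_iff
  proof (intro conjI allI impI)
    fix A :: "'a bilattice" assume "DB_minus A"
    then interpret conflation_bilattice A by (rule conflation_bilattice.intro)
    show "double_ockham (dual_space M_alg NN_struct A)" by (rule double_ockham_D)
    show "eval_alg M_alg A \<in> alg_iso A (dual_algebra M_alg NN_struct (dual_space M_alg NN_struct A))"
      by (rule eval_alg_iso)
  next
    fix X :: "'x tstruct" assume "double_ockham X"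
    then show "DB_minus (dual_algebra M_alg NN_struct X)"
      by (intro DB_minus_dual_algebra double_ockham_imp_wf)
  qed
  then have "yields_full_duality TYPE('a) TYPE('x) M_alg NN_struct"
    unfolding yields_full_duality_def IScP_plus_NN_iff using eval_struct_iso by blast
  moreover have "injective_in_IScP_plus TYPE('x) TYPE('y) NN_struct"
    unfolding injective_in_IScP_plus_def IScP_plus_NN_iff using mor_NN_extension by blast
  ultimately show "yields_strong_duality TYPE('a) TYPE('x) TYPE('y) M_alg NN_struct"
    unfolding yields_strong_duality_def by blast
next
  fix X :: "'x tstruct"
  show "in_IScP_plus NN_struct X \<longleftrightarrow> in_IScP_plus N_struct X"
    by (simp only: IScP_plus_NN_iff IScP_plus_N_iff)
  show "in_IScP_plus N_struct X \<longleftrightarrow> double_ockham X"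
    by (rule IScP_plus_N_iff)
next
  fix X :: "'x tstruct" and Y :: "'y tstruct"
  show "mor X Y = double_ockham_mor (tp X) (rel X) (op1 X) (op2 X) (tp Y) (rel Y) (op1 Y) (op2 Y)"
    unfolding mor_def double_ockham_mor_def by blast
qed

end
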